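(* Let $n\in\mathbb{N}$, $k\geq2$, $u\equiv a_{i_1}a_{i_2}\cdots a_{i_k}$ and letters $x,y$, with $x,y,a_{i_1},\dots,a_{i_k}\in\{a_1,\dots,a_n\}$, and let $S=sgp^+\langle a_1,\dots,a_n\mid u=xy\rangle$, where $\{u=xy\}$ is a Gröbner–Shirshov basis. If $a_{i_{k-1}}a_{i_k}\not\equiv xy$ and $u\not\equiv y^{k-1}x$, then $S$ is automatic and $S^1$ is prefix-automatic.
   Context: $A^*$ is the free monoid (empty word $\varepsilon$), $A^+=A^*\setminus\{\varepsilon\}$, $\equiv$ is equality of words. $sgp^+\langle A\mid R\rangle$ is $A^+$ modulo the congruence generated by $R$. For $S=sgp^+\langle A\mid R\rangle$, $S^1=sgp^+\langle A\cup\{e\}\mid R,\ ea=ae=a\ (a\in A),\ ee=e\rangle$ ($e$ a new letter, the identity of $S^1$). Gröbner–Shirshov bases: fix a well-ordering of $A$ and the deg-lex ordering on $A^*$ (length, then lexicographic). For monic polynomials $f,g$ in the free associative algebra $F\langle A\rangle$ over a field with leading words $\bar f,\bar g$: if $w\equiv\bar f b\equiv a\bar g$ with $|\bar f|+|\bar g|>|w|$, $(f,g)_w=fb-ag$; if $w\equiv\bar f\equiv a\bar g b$, $(f,g)_w=f-agb$; trivial modulo $(R,w)$ if it equals $\sum\alpha_i a_i s_i b_i$ with $s_i\in R$, $a_i\bar{s_i}b_i<w$. $R$ is a Gröbner–Shirshov basis if all compositions are trivial; $\{u=xy\}$ is one if $\{u-xy\}$ is. Automaticity: regular = accepted by a finite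 automaton. With $\$\notin A$, $A(2,\$)=(A\cup\{\$\})^2\setminus\{(\$,\$)\}$; $(\alpha,\beta)\delta_A^R$ is the word over $A(2,\$)$ obtained by padding the shorter word on the right with $\$$'s and reading letter pairs. For a semigroup generated by finite $A$, $\phi:A^+\to S$ canonical, $L\subseteq A^+$ regular with $\phi(L)=S$, write $\alpha=\beta$ if $\phi(\alpha)=\phi(\beta)$ and $L_a^\$=\{(\alpha,\beta)\delta^R_A:\alpha,\beta\in L,\alpha a=\beta\}$ for $a\in A\cup\{\varepsilon\}$. $S$ is automatic if some such $(A,L)$ has all $L_a^\$$ regular; prefix-automatic if some such automatic structure also has $\{(\alpha,\beta)\delta_A^R:\alpha\in L,\beta\in\mathrm{Pref}(L),\alpha=\beta\}$ regular ($\mathrm{Pref}(L)$ = prefixes of words of $L$). *)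

theory Defs
  imports Main
begin

inductive_set congr_gen :: "('a list \<times> 'a list) set \<Rightarrow> ('a list \<times> 'a list) set"
  for R :: "('a list \<times> 'a list) set" where
  base: "(u, v) \<in> R \<Longrightarrow> (p @ u @ q, p @ v @ q) \<in> congr_gen R"
| refl: "(w, w) \<in> congr_gen R"
| sym: "(u, v) \<in> congr_gen R \<Longrightarrow> (v, u) \<in> congr_gen R"
| trans: "(u, v) \<in> congr_gen R \<Longrightarrow> (v, w) \<in> congr_gen R \<Longrightarrow> (u, w) \<in> congr_gen R"

definition cls :: "'a set \<Rightarrow> ('a list \<times> 'a list) set \<Rightarrow> 'a list \<Rightarrow> 'a list set" where
  "cls A R w = {v \<in> lists A. (w, v) \<in> congr_gen R}"

definition sgp_carrier :: "'a set \<Rightarrow> ('a list \<times> 'a list) set \<Rightarrow> 'a list set set" where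
  "sgp_carrier A R = cls A R ` (lists A - {[]})"

definition sgp_mult :: "'a set \<Rightarrow> ('a list \<times> 'a list) set \<Rightarrow> 'a list set \<Rightarrow> 'a list set \<Rightarrow> 'a list set" where
  "sgp_mult A R X Y = cls A R ((SOME w. w \<in> X) @ (SOME w. w \<in> Y))"

text \<open>S^1: adjoin a new letter e (here the letter 0, assumed not in A) with
  relations e a = a e = a (a in A), e e = e.\<close>
definition one_alph :: "nat set \<Rightarrow> nat set" where
  "one_alph A = insert 0 A"

definition one_rels :: "nat set \<Rightarrow> (nat list \<times> nat list) set \<Rightarrow> (nat list \<times> nat list) set" where
  "one_rels A R = R \<union> {([0, a], [a]) | a. a \<in> A} \<union> {([a, 0], [a]) | a. a \<in> A} \<union> {([0, 0], [0])}"

text \<open>Deg-lex ordering on words, for a well-ordering of the (finite) alphabet given by an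
  injective rank function rho.\<close>
definition dlex_less :: "(nat \<Rightarrow> nat) \<Rightarrow> nat list \<Rightarrow> nat list \<Rightarrow> bool" where
  "dlex_less \<rho> v w \<longleftrightarrow> length v < length w \<or>
     (length v = length w \<and> (v, w) \<in> lexord {(a, b). \<rho> a < \<rho> b})"

text \<open>Noncommutative polynomials are represented by their coefficient functions on words.\<close>
definition poly_over :: "nat set \<Rightarrow> (nat list \<Rightarrow> 'k::field) \<Rightarrow> bool" where
  "poly_over A f \<longleftrightarrow> finite {w. f w \<noteq> 0} \<and> {w. f w \<noteq> 0} \<subseteq> lists A"

definition is_lead :: "(nat \<Rightarrow> nat) \<Rightarrow> (nat list \<Rightarrow> 'k::field) \<Rightarrow> nat list \<Rightarrow> bool" where
  "is_lead \<rho> f w \<longleftrightarrow> f w \<noteq> 0 \<and> (\<forall>v. f v \<noteq> 0 \<longrightarrow> v = w \<or> dlex_less \<rho> v w)"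

definition lead :: "(nat \<Rightarrow> nat) \<Rightarrow> (nat list \<Rightarrow> 'k::field) \<Rightarrow> nat list" where
  "lead \<rho> f = (THE w. is_lead \<rho> f w)"

definition monic :: "(nat \<Rightarrow> nat) \<Rightarrow> (nat list \<Rightarrow> 'k::field) \<Rightarrow> bool" where
  "monic \<rho> f \<longleftrightarrow> (\<exists>w. is_lead \<rho> f w \<and> f w = 1)"

definition wmul :: "nat list \<Rightarrow> (nat list \<Rightarrow> 'k::field) \<Rightarrow> nat list \<Rightarrow> nat list \<Rightarrow> 'k" where
  "wmul a f b w = (if \<exists>v. w = a @ v @ b then f (THE v. w = a @ v @ b) else 0)"

definition trivial_mod :: "(nat \<Rightarrow> nat) \<Rightarrow> nat set \<Rightarrow> (nat list \<Rightarrow> 'k::field) set \<Rightarrow> nat list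
    \<Rightarrow> (nat list \<Rightarrow> 'k) \<Rightarrow> bool" where
  "trivial_mod \<rho> A R w h \<longleftrightarrow>
     (\<exists>(m::nat) (\<alpha>::nat \<Rightarrow> 'k) a s b.
        (\<forall>i<m. s i \<in> R \<and> a i \<in> lists A \<and> b i \<in> lists A \<and>
               dlex_less \<rho> (a i @ lead \<rho> (s i) @ b i) w) \<and>
        (\<forall>v. h v = (\<Sum>i<m. \<alpha> i * wmul (a i) (s i) (b i) v)))"

definition GSB :: "(nat \<Rightarrow> nat) \<Rightarrow> nat set \<Rightarrow> (nat list \<Rightarrow> 'k::field) set \<Rightarrow> bool" where
  "GSB \<rho> A R \<longleftrightarrow>
     (\<forall>f\<in>R. poly_over A f \<and> monic \<rho> f) \<and>
     (\<forall>f\<in>R. \<forall>g\<in>R. \<forall>w a b. a \<in> lists A \<and> b \<in> lists A \<longrightarrow>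
        ((w = lead \<rho> f @ b \<and> w = a @ lead \<rho> g \<and>
          length (lead \<rho> f) + length (lead \<rho> g) > length w)
           \<longrightarrow> trivial_mod \<rho> A R w (\<lambda>v. wmul [] f b v - wmul a g [] v)) \<and>
        ((w = lead \<rho> f \<and> w = a @ lead \<rho> g @ b)
           \<longrightarrow> trivial_mod \<rho> A R w (\<lambda>v. f v - wmul a g b v)))"

definition regular :: "'b set \<Rightarrow> 'b list set \<Rightarrow> bool" where
  "regular \<Sigma> L \<longleftrightarrow> L \<subseteq> lists \<Sigma> \<and>
     (\<exists>(Q::nat set) q0 (\<delta>::nat \<Rightarrow> 'b \<Rightarrow> nat) F. finite Q \<and> q0 \<in> Q \<and>
        (\<forall>q\<in>Q. \<forall>c\<in>\<Sigma>. \<delta> q c \<in> Q) \<and> F \<subseteq> Q \<and>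
        L = {w \<in> lists \<Sigma>. fold (\<lambda>c q. \<delta> q c) w q0 \<in> F})"

fun ev :: "('s \<Rightarrow> 's \<Rightarrow> 's) \<Rightarrow> 's list \<Rightarrow> 's" where
  "ev m [] = undefined"
| "ev m [s] = s"
| "ev m (s # t # ts) = m s (ev m (t # ts))"

fun pad :: "'a list \<Rightarrow> 'a list \<Rightarrow> ('a option \<times> 'a option) list" where
  "pad [] [] = []"
| "pad (a # as) [] = (Some a, None) # pad as []"
| "pad [] (b # bs) = (None, Some b) # pad [] bs"
| "pad (a # as) (b # bs) = (Some a, Some b) # pad as bs"

definition pair_alph :: "'a set \<Rightarrow> ('a option \<times> 'a option) set" where
  "pair_alph A = (insert None (Some ` A) \<times> insert None (Some ` A)) - {(None, None)}"

definition Pref :: "'a list set \<Rightarrow> 'a list set" where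
  "Pref L = {\<beta>. \<exists>\<gamma>. \<beta> @ \<gamma> \<in> L}"

definition auto_structure :: "'s set \<Rightarrow> ('s \<Rightarrow> 's \<Rightarrow> 's) \<Rightarrow> 's set \<Rightarrow> 's list set \<Rightarrow> bool" where
  "auto_structure S m A L \<longleftrightarrow>
     finite A \<and> A \<subseteq> S \<and> L \<subseteq> lists A - {[]} \<and> regular A L \<and> ev m ` L = S \<and>
     regular (pair_alph A) {pad \<alpha> \<beta> | \<alpha> \<beta>. \<alpha> \<in> L \<and> \<beta> \<in> L \<and> ev m \<alpha> = ev m \<beta>} \<and>
     (\<forall>a\<in>A. regular (pair_alph A)
        {pad \<alpha> \<beta> | \<alpha> \<beta>. \<alpha> \<in> L \<and> \<beta> \<in> L \<and> ev m (\<alpha> @ [a]) = ev m \<beta>})"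

definition automatic :: "'s set \<Rightarrow> ('s \<Rightarrow> 's \<Rightarrow> 's) \<Rightarrow> bool" where
  "automatic S m \<longleftrightarrow> (\<exists>A L. auto_structure S m A L)"

definition prefix_automatic :: "'s set \<Rightarrow> ('s \<Rightarrow> 's \<Rightarrow> 's) \<Rightarrow> bool" where
  "prefix_automatic S m \<longleftrightarrow> (\<exists>A L. auto_structure S m A L \<and>
     regular (pair_alph A)
       {pad \<alpha> \<beta> | \<alpha> \<beta>. \<alpha> \<in> L \<and> \<beta> \<in> Pref L \<and> \<beta> \<noteq> [] \<and> ev m \<alpha> = ev m \<beta>})"

end

theory Submission
  imports Defs "HOL-Library.Sublist"
begin

text \<open>The hypothesis makes the single rule \<open>u \<rightarrow> xy\<close> convergent, so that the words avoiding \<open>u\<close> as a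
  factor represent the elements of the semigroup uniquely. Write \<open>u = vc\<close>. Right multiplication of
  such a word by a letter can trigger more than one rewriting step only if \<open>c = x\<close>, and then it
  turns \<open>\<gamma>v\<^sup>m\<close> into \<open>\<gamma>xy\<^sup>m\<close>. These words have incompatible lengths if \<open>length v > 1\<close>. Therefore
  \<open>v\<close> is added as a generator, and words are coded by replacing occurrences of \<open>v\<close> greedily from the
  left. While a factor \<open>v\<close> is read, exactly one such replacement takes place, so \<open>\<gamma>v\<^sup>m\<close> is coded, up to
  boundedly many letters, as \<open>\<gamma>\<close> followed by \<open>m\<close> copies of the new generator. On the other side
  \<open>y\<^sup>m\<close> stays as it is because \<open>v\<close> is not a power of \<open>y\<close>. The set of codes is closed under
  prefixes, whence prefix-automaticity after adding the identity as one more code word.\<close>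

section \<open>Languages with finitely many left quotients\<close>

text \<open>The two exclusions on \<open>u\<close> guard different places. If \<open>u\<close> ended
  in \<open>xy\<close>, a letter \<open>y\<close> produced by a rewriting step could complete a new
  redex, and the word \<gamma>xy^m need not be irreducible. If \<open>u\<close> were y^(k-1)x with k
  > 2, then v^m would itself be a power of \<open>y\<close>: the relation y^(k-1)x = xy multiplies
  exponents as in a Baumslag-Solitar group, and block coding would shorten both sides at the same
  rate, leaving their lengths in ratio k-1 to 1. In the remaining cases both code words grow by
  exactly one generator per unit of m, so that their padded pair is a pumped pair of letters between
  bounded ends.

  Only multiplication by a single letter needs analysis; multiplication by the extra generator is a
  composition of such relations. Distinct code letters may name the same element of
  \<open>S\<close>, so all languages are built over words and are mapped to classes letter by letter
  at the end.\<close>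

definition lquot :: "'a list \<Rightarrow> 'a list set \<Rightarrow> 'a list set" where
  "lquot w L = {v. w @ v \<in> L}"

text \<open>The Myhill-Nerode form of regularity, without reference to an alphabet. A closure
  property then only needs a formula for the quotients of the new language in terms of those of the
  given ones.\<close>

definition fin_quot :: "'a list set \<Rightarrow> bool" where
  "fin_quot L \<longleftrightarrow> finite (range (\<lambda>w. lquot w L))"

lemma lquot_Nil [simp]: "lquot [] L = L"
  by (simp add: lquot_def)

lemma lquot_append: "lquot (v @ w) L = lquot w (lquot v L)"
  by (simp add: lquot_def)

lemma fin_quotI: "finite F \<Longrightarrow> (\<And>w. lquot w L \<in> F) \<Longrightarrow> fin_quot L"
  unfolding fin_quot_def by (rule finite_subset[of _ F]) auto

lemma fin_quot_closed_family:
  assumes "finite F" "L \<in> F" and "\<And>X c. X \<in> F \<Longrightarrow> lquot [c] X \<in> F"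
  shows "fin_quot L"
proof (rule fin_quotI[OF assms(1)])
  fix w
  show "lquot w L \<in> F"
  proof (induction w rule: rev_induct)
    case (snoc c w)
    then show ?case using assms(3) by (simp add: lquot_append)
  qed (simp add: assms(2))
qed

text \<open>The quotients are the states of the minimal automaton; \<open>g\<close> numbers them
  because \<open>regular\<close> asks for natural numbers as states.\<close>

lemma regular_if_fin_quot:
  assumes "fin_quot L" and sub: "L \<subseteq> lists \<Sigma>"
  shows "regular \<Sigma> L"
proof -
  define Qs where "Qs = range (\<lambda>w. lquot w L)"
  have fin: "finite Qs" using assms by (simp add: fin_quot_def Qs_def)
  then obtain g :: "'a list set \<Rightarrow> nat" where inj: "inj_on g Qs"
    using finite_imp_inj_to_nat_seg by metis
  define \<delta> where "\<delta> q c = g (lquot [c] (inv_into Qs g q))" for q c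
  have lq: "lquot w L \<in> Qs" for w by (simp add: Qs_def)
  have d: "\<delta> (g (lquot w L)) c = g (lquot (w @ [c]) L)" for w c
    using inj lq by (simp add: \<delta>_def lquot_append)
  have run: "fold (\<lambda>c q. \<delta> q c) w (g (lquot v L)) = g (lquot (v @ w) L)" for v w
  proof (induction w arbitrary: v)
    case (Cons c w)
    show ?case using Cons[of "v @ [c]"] by (simp add: d)
  qed simp
  let ?F = "g ` {X \<in> Qs. [] \<in> X}"
  have acc: "g (lquot w L) \<in> ?F \<longleftrightarrow> w \<in> L" for w
  proof
    assume "g (lquot w L) \<in> ?F"
    then obtain X where "X \<in> Qs" "[] \<in> X" "g (lquot w L) = g X" by auto
    then have "[] \<in> lquot w L" using inj lq by (metis inj_onD)
    then show "w \<in> L" by (simp add: lquot_def)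
  next
    assume "w \<in> L"
    then show "g (lquot w L) \<in> ?F" using lq by (auto simp: lquot_def)
  qed
  have "L = {w \<in> lists \<Sigma>. fold (\<lambda>c q. \<delta> q c) w (g L) \<in> ?F}"
    using run[of _ "[]"] acc sub by auto
  moreover have "\<forall>q\<in>g ` Qs. \<forall>c\<in>\<Sigma>. \<delta> q c \<in> g ` Qs"
    using d lq by (auto simp: Qs_def)
  moreover have "g L \<in> g ` Qs" using lq[of "[]"] by simp
  ultimately show ?thesis
    unfolding regular_def using sub fin
    by (intro conjI exI[of _ "g ` Qs"] exI[of _ "g L"] exI[of _ \<delta>] exI[of _ ?F]) auto
qed

lemma fin_quot_map2:
  assumes "fin_quot K" "fin_quot L" and "\<And>w. lquot w M = f (lquot w K) (lquot w L)"
  shows "fin_quot M"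
proof (rule fin_quotI)
  show "finite ((\<lambda>(X, Y). f X Y) ` (range (\<lambda>w. lquot w K) \<times> range (\<lambda>w. lquot w L)))"
    using assms(1,2) by (simp add: fin_quot_def)
  show "lquot w M \<in> (\<lambda>(X, Y). f X Y) ` (range (\<lambda>w. lquot w K) \<times> range (\<lambda>w. lquot w L))" for w
    using assms(3)[of w] by auto
qed

lemma fin_quot_Un: "fin_quot K \<Longrightarrow> fin_quot L \<Longrightarrow> fin_quot (K \<union> L)"
  by (erule (1) fin_quot_map2[where f = "(\<union>)"]) (auto simp: lquot_def)

lemma fin_quot_Int: "fin_quot K \<Longrightarrow> fin_quot L \<Longrightarrow> fin_quot (K \<inter> L)"
  by (erule (1) fin_quot_map2[where f = "(\<inter>)"]) (auto simp: lquot_def)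

lemma fin_quot_Compl: "fin_quot L \<Longrightarrow> fin_quot (- L)"
  by (rule fin_quot_map2[where f = "\<lambda>X _. - X"]) (auto simp: lquot_def)

lemma fin_quot_empty [simp]: "fin_quot {}"
  by (rule fin_quot_closed_family[of "{{}}"]) (auto simp: lquot_def)

lemma fin_quot_UNIV [simp]: "fin_quot UNIV"
  by (rule fin_quot_closed_family[of "{UNIV}"]) (auto simp: lquot_def)

lemma fin_quot_singleton: "fin_quot {w}"
proof (induction w)
  case Nil
  show ?case by (rule fin_quot_closed_family[of "{{[]}, {}}"]) (auto simp: lquot_def)
next
  case (Cons a w)
  let ?F = "insert {a # w} (insert {} (range (\<lambda>v. lquot v {w})))"
  show ?case
  proof (rule fin_quot_closed_family[of ?F])
    show "finite ?F" using Cons by (simp add: fin_quot_def)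
    fix X c assume "X \<in> ?F"
    then consider "X = {a # w}" | "X = {}" | v where "X = lquot v {w}" by auto
    then show "lquot [c] X \<in> ?F"
    proof cases
      case 1
      then have "lquot [c] X = (if c = a then lquot [] {w} else {})" by (auto simp: lquot_def)
      then show ?thesis using rangeI[of "\<lambda>v. lquot v {w}" "[]"] by (cases "c = a") simp_all
    next
      case 2
      then show ?thesis by (simp add: lquot_def)
    next
      case 3
      then show ?thesis by (metis insertCI lquot_append rangeI)
    qed
  qed simp
qed

lemma fin_quot_UNION: "finite I \<Longrightarrow> (\<And>i. i \<in> I \<Longrightarrow> fin_quot (L i)) \<Longrightarrow> fin_quot (\<Union>i\<in>I. L i)"
  by (induction I rule: finite_induct) (auto intro: fin_quot_Un)

lemma fin_quot_finite: "finite L \<Longrightarrow> fin_quot L"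
  using fin_quot_UNION[of L "\<lambda>w. {w}", OF _ fin_quot_singleton] by simp

definition lconc :: "'a list set \<Rightarrow> 'a list set \<Rightarrow> 'a list set" where
  "lconc K L = {v @ w | v w. v \<in> K \<and> w \<in> L}"

lemma lquot_lconc:
  "lquot w (lconc K L) = lconc (lquot w K) L \<union> \<Union> {lquot s L | s. \<exists>p\<in>K. w = p @ s}"
proof (intro set_eqI iffI)
  fix t assume "t \<in> lquot w (lconc K L)"
  then obtain a b where ab: "w @ t = a @ b" "a \<in> K" "b \<in> L" by (auto simp: lquot_def lconc_def)
  then obtain c where "w = a @ c \<and> c @ t = b \<or> w @ c = a \<and> t = c @ b"
    by (auto simp: append_eq_append_conv2)
  then show "t \<in> lconc (lquot w K) L \<union> \<Union> {lquot s L | s. \<exists>p\<in>K. w = p @ s}"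
  proof
    assume "w = a @ c \<and> c @ t = b"
    then show ?thesis using ab by (intro UnI2 UnionI[of "lquot c L"]) (auto simp: lquot_def)
  next
    assume "w @ c = a \<and> t = c @ b"
    then show ?thesis using ab by (auto simp: lquot_def lconc_def)
  qed
next
  fix t assume "t \<in> lconc (lquot w K) L \<union> \<Union> {lquot s L | s. \<exists>p\<in>K. w = p @ s}"
  then show "t \<in> lquot w (lconc K L)"
  proof
    assume "t \<in> lconc (lquot w K) L"
    then show ?thesis by (auto simp: lquot_def lconc_def) (metis append.assoc)
  next
    assume "t \<in> \<Union> {lquot s L | s. \<exists>p\<in>K. w = p @ s}"
    then show ?thesis by (auto simp: lquot_def lconc_def) blast
  qed
qed

text \<open>As in the subset construction, a quotient of the product is determined by one quotient
  of \<open>K\<close> and a set of quotients of \<open>L\<close>, one for each way of leaving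
  \<open>K\<close> while reading \<open>w\<close>.\<close>

lemma fin_quot_lconc:
  assumes "fin_quot K" "fin_quot L"
  shows "fin_quot (lconc K L)"
proof (rule fin_quotI)
  let ?F = "(\<lambda>(X, Y). lconc X L \<union> \<Union> Y) ` (range (\<lambda>w. lquot w K) \<times> Pow (range (\<lambda>w. lquot w L)))"
  show "finite ?F" using assms by (simp add: fin_quot_def)
  show "lquot w (lconc K L) \<in> ?F" for w
    unfolding lquot_lconc by (rule image_eqI[of _ _ "(lquot w K, _)"]) auto
qed

lemma fin_quot_vimage_hom:
  assumes "fin_quot L" and "\<And>v w. h (v @ w) = h v @ h w"
  shows "fin_quot {w. h w \<in> L}"
proof (rule fin_quotI)
  show "finite ((\<lambda>X. {w. h w \<in> X}) ` range (\<lambda>w. lquot w L))"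
    using assms(1) by (simp add: fin_quot_def)
  show "lquot w {w. h w \<in> L} \<in> (\<lambda>X. {w. h w \<in> X}) ` range (\<lambda>w. lquot w L)" for w
    by (rule image_eqI[of _ _ "lquot (h w) L"]) (auto simp: lquot_def assms(2))
qed

text \<open>A word can have several preimages under \<open>map h\<close>, so a quotient of the image
  is a union over a set of quotients of \<open>L\<close>.\<close>

lemma fin_quot_image_map:
  assumes "fin_quot L"
  shows "fin_quot (map h ` L)"
proof (rule fin_quotI)
  let ?F = "(\<lambda>Y. \<Union>X\<in>Y. map h ` X) ` Pow (range (\<lambda>w. lquot w L))"
  show "finite ?F" using assms by (simp add: fin_quot_def)
  fix w
  have "lquot w (map h ` L) = (\<Union>X\<in>{lquot v L | v. map h v = w}. map h ` X)"
    by (auto simp: lquot_def append_eq_map_conv image_iff)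
  then show "lquot w (map h ` L) \<in> ?F" by (rule image_eqI) auto
qed

lemma fin_quot_rquot:
  assumes "fin_quot L"
  shows "fin_quot {w. \<exists>s\<in>S. w @ s \<in> L}"
proof (rule fin_quotI)
  let ?f = "\<lambda>X. {w. \<exists>s\<in>S. w @ s \<in> X}"
  show "finite (?f ` range (\<lambda>w. lquot w L))" using assms by (simp add: fin_quot_def)
  show "lquot w (?f L) \<in> ?f ` range (\<lambda>w. lquot w L)" for w
    by (rule image_eqI[of _ _ "lquot w L"]) (auto simp: lquot_def)
qed

lemma fin_quot_lists: "fin_quot (lists A)"
  by (rule fin_quot_closed_family[of "{lists A, {}}"]) (auto simp: lquot_def)

lemma fin_quot_replicate: "fin_quot (range (\<lambda>j. replicate j c))"
proof -
  have "range (\<lambda>j. replicate j c) = lists {c}"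
  proof (intro set_eqI iffI)
    fix w assume "w \<in> lists {c}"
    then have "w = replicate (length w) c" by (induction w) auto
    then show "w \<in> range (\<lambda>j. replicate j c)" by blast
  qed auto
  then show ?thesis using fin_quot_lists by metis
qed

lemma fin_quot_pump: "fin_quot (range (\<lambda>j. P @ replicate j c @ Q))"
proof -
  have "range (\<lambda>j. P @ replicate j c @ Q) = lconc {P} (lconc (range (\<lambda>j. replicate j c)) {Q})"
    by (auto simp: lconc_def)
  then show ?thesis by (simp add: fin_quot_lconc fin_quot_singleton fin_quot_replicate)
qed

text \<open>The members below \<open>N\<close> are finitely many exceptions. Families indexed by the
  exponent m of a power will be brought into this form.\<close>

lemma fin_quot_eventually_pump:
  assumes "\<And>j. f (N + j) = P @ replicate j c @ Q"
  shows "fin_quot (range f)"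
proof -
  have "m < N \<or> (\<exists>j. m = N + j)" for m by presburger
  then have "range f = f ` {..<N} \<union> range (\<lambda>j. f (N + j))" by (auto simp: image_iff)
  then show ?thesis
    using assms fin_quot_pump[of P c Q] by (simp add: fin_quot_Un fin_quot_finite)
qed

section \<open>Relations on words as languages of padded pairs\<close>

definition conv_lang :: "('a list \<times> 'a list) set \<Rightarrow> ('a option \<times> 'a option) list set" where
  "conv_lang R = {pad \<alpha> \<beta> | \<alpha> \<beta>. (\<alpha>, \<beta>) \<in> R}"

abbreviation opt_nth :: "'a list \<Rightarrow> nat \<Rightarrow> 'a option" where
  "opt_nth w i \<equiv> (if i < length w then Some (w ! i) else None)"

text \<open>Padding to a prescribed length instead of the length of the longer word. With a common
  length for all pairs, the tracks of a three-tape word can be compared position by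
  position.\<close>

definition conv_upto :: "nat \<Rightarrow> 'a list \<Rightarrow> 'a list \<Rightarrow> ('a option \<times> 'a option) list" where
  "conv_upto N \<alpha> \<beta> = map (\<lambda>i. (opt_nth \<alpha> i, opt_nth \<beta> i)) [0..<N]"

lemma conv_upto_Cons:
  "conv_upto (Suc N) \<alpha> \<beta> =
    (opt_nth \<alpha> 0, opt_nth \<beta> 0) # conv_upto N (tl \<alpha>) (tl \<beta>)"
  unfolding conv_upto_def
  by (rule nth_equalityI) (auto simp: nth_Cons nth_tl simp del: upt_Suc split: nat.splits)

lemma conv_upto_eq_pad:
  "max (length \<alpha>) (length \<beta>) \<le> N \<Longrightarrow>
    conv_upto N \<alpha> \<beta> = pad \<alpha> \<beta> @ replicate (N - max (length \<alpha>) (length \<beta>)) (None, None)"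
proof (induction \<alpha> \<beta> arbitrary: N rule: pad.induct)
  case 1
  show ?case by (simp add: conv_upto_def map_replicate_const)
next
  case (2 a as)
  then show ?case by (cases N) (auto simp: conv_upto_Cons)
next
  case (3 b bs)
  then show ?case by (cases N) (auto simp: conv_upto_Cons)
next
  case (4 a as b bs)
  then show ?case by (cases N) (auto simp: conv_upto_Cons)
qed

lemma pad_eq_conv_upto: "pad \<alpha> \<beta> = conv_upto (max (length \<alpha>) (length \<beta>)) \<alpha> \<beta>"
  by (simp add: conv_upto_eq_pad)

text \<open>Deleting blanks recovers a track, so \<open>pad\<close> is injective. Deletion is also a
  monoid homomorphism, which turns conditions on one track into preimages of languages.\<close>

lemma somes_fst_pad: "List.map_filter fst (pad \<alpha> \<beta>) = \<alpha>"
  by (induction \<alpha> \<beta> rule: pad.induct) (auto simp: map_filter_simps)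

lemma somes_snd_pad: "List.map_filter snd (pad \<alpha> \<beta>) = \<beta>"
  by (induction \<alpha> \<beta> rule: pad.induct) (auto simp: map_filter_simps)

lemma pad_inject: "pad \<alpha> \<beta> = pad \<alpha>' \<beta>' \<longleftrightarrow> \<alpha> = \<alpha>' \<and> \<beta> = \<beta>'"
  by (metis somes_fst_pad somes_snd_pad)

lemma conv_lang_Int: "conv_lang (R \<inter> R') = conv_lang R \<inter> conv_lang R'"
  by (auto simp: conv_lang_def pad_inject)

lemma conv_lang_Un: "conv_lang (R \<union> R') = conv_lang R \<union> conv_lang R'"
  by (auto simp: conv_lang_def)

text \<open>Three live states: both words are still running, only the first is, or only the second
  is. Once a word has ended it never resumes.\<close>

lemma fin_quot_range_pad: "fin_quot (conv_lang UNIV)"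
proof -
  let ?X = "conv_lang UNIV" and ?Y = "range (\<lambda>\<alpha>. pad \<alpha> [])" and ?Z = "range (\<lambda>\<beta>. pad [] \<beta>)"
  have X: "(c # w) \<in> ?X \<longleftrightarrow> (case c of (Some a, Some b) \<Rightarrow> w \<in> ?X | (Some a, None) \<Rightarrow> w \<in> ?Y
      | (None, Some b) \<Rightarrow> w \<in> ?Z | _ \<Rightarrow> False)" (is "?l \<longleftrightarrow> ?r") for c w
  proof
    assume ?l
    then obtain \<alpha> \<beta> where "c # w = pad \<alpha> \<beta>" by (auto simp: conv_lang_def)
    then show ?r by (cases \<alpha>; cases \<beta>) (auto simp: conv_lang_def)
  next
    assume ?r
    then show ?l
      by (auto simp: conv_lang_def split: prod.splits option.splits) (metis pad.simps(2-4))+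
  qed
  have Y: "(c # w) \<in> ?Y \<longleftrightarrow> (\<exists>a. c = (Some a, None)) \<and> w \<in> ?Y" (is "?l \<longleftrightarrow> ?r") for c w
  proof
    assume ?l
    then obtain \<alpha> where "c # w = pad \<alpha> []" by auto
    then show ?r by (cases \<alpha>) auto
  next
    assume ?r
    then show ?l by auto (metis pad.simps(2) rangeI)
  qed
  have Z: "(c # w) \<in> ?Z \<longleftrightarrow> (\<exists>a. c = (None, Some a)) \<and> w \<in> ?Z" (is "?l \<longleftrightarrow> ?r") for c w
  proof
    assume ?l
    then obtain \<alpha> where "c # w = pad [] \<alpha>" by auto
    then show ?r by (cases \<alpha>) auto
  next
    assume ?r
    then show ?l by auto (metis pad.simps(3) rangeI)
  qed
  have eq: "lquot [c] ?X = (case c of (Some a, Some b) \<Rightarrow> ?X | (Some a, None) \<Rightarrow> ?Y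
      | (None, Some b) \<Rightarrow> ?Z | _ \<Rightarrow> {})"
    "lquot [c] ?Y = (if \<exists>a. c = (Some a, None) then ?Y else {})"
    "lquot [c] ?Z = (if \<exists>a. c = (None, Some a) then ?Z else {})" for c
    unfolding lquot_def append_Cons append_Nil X Y Z
    by (auto split: prod.splits option.splits)
  show ?thesis
  proof (rule fin_quot_closed_family[of "{?X, ?Y, ?Z, {}}"])
    fix K c assume "K \<in> {?X, ?Y, ?Z, {}}"
    then consider "K = ?X" | "K = ?Y" | "K = ?Z" | "K = {}" by blast
    then show "lquot [c] K \<in> {?X, ?Y, ?Z, {}}"
    proof cases
      case 1
      show ?thesis unfolding 1 eq(1) by (simp split: prod.splits option.splits)
    next
      case 2
      show ?thesis unfolding 2 eq(2) by simp
    next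
      case 3
      show ?thesis unfolding 3 eq(3) by simp
    next
      case 4
      then show ?thesis by (simp add: lquot_def)
    qed
  qed auto
qed

lemma map_filter_append: "List.map_filter f (v @ w) = List.map_filter f v @ List.map_filter f w"
  by (simp add: List.map_filter_def)

lemma fin_quot_conv_Times:
  assumes "fin_quot K" "fin_quot L"
  shows "fin_quot (conv_lang (K \<times> L))"
proof -
  have "conv_lang (K \<times> L) = conv_lang UNIV \<inter> {w. List.map_filter fst w \<in> K}
      \<inter> {w. List.map_filter snd w \<in> L}"
    by (auto simp: conv_lang_def somes_fst_pad somes_snd_pad) metis
  then show ?thesis
    using assms
    by (simp add: fin_quot_Int fin_quot_range_pad fin_quot_vimage_hom map_filter_append)
qed

lemma pad_append_same: "pad (\<delta> @ \<alpha>) (\<delta> @ \<beta>) = map (\<lambda>a. (Some a, Some a)) \<delta> @ pad \<alpha> \<beta>"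
  by (induction \<delta>) auto

lemma pad_same: "pad \<delta> \<delta> = map (\<lambda>a. (Some a, Some a)) \<delta>"
  by (induction \<delta>) auto

lemma fin_quot_conv_Id: "fin_quot (conv_lang Id)"
proof -
  have "conv_lang Id = map (\<lambda>a. (Some a, Some a)) ` (UNIV :: 'a list set)"
    by (auto simp: conv_lang_def pad_same)
  then show ?thesis by (simp add: fin_quot_image_map)
qed

text \<open>A common prefix is read along the diagonal, without any shift between the tracks. Right
  multiplication is later reduced to a change of tails behind such a prefix.\<close>

lemma fin_quot_conv_common_prefix:
  assumes "fin_quot (conv_lang T)"
  shows "fin_quot (conv_lang {(\<delta> @ s, \<delta> @ t) | \<delta> s t. (s, t) \<in> T})"
proof -
  have "conv_lang {(\<delta> @ s, \<delta> @ t) | \<delta> s t. (s, t) \<in> T} = lconc (conv_lang Id) (conv_lang T)"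
    (is "?l = ?r")
  proof (intro set_eqI iffI)
    fix w assume "w \<in> ?l"
    then obtain \<delta> s t where "w = pad (\<delta> @ s) (\<delta> @ t)" "(s, t) \<in> T"
      unfolding conv_lang_def by blast
    then have "w = pad \<delta> \<delta> @ pad s t" "(s, t) \<in> T" by (simp_all add: pad_append_same pad_same)
    then show "w \<in> ?r" unfolding conv_lang_def lconc_def by blast
  next
    fix w assume "w \<in> ?r"
    then obtain \<delta> s t where "w = pad \<delta> \<delta> @ pad s t" "(s, t) \<in> T"
      unfolding conv_lang_def lconc_def by blast
    then have "w = pad (\<delta> @ s) (\<delta> @ t)" "(s, t) \<in> T" by (simp_all add: pad_append_same pad_same)
    then show "w \<in> ?l" unfolding conv_lang_def by blast
  qed
  then show ?thesis using assms by (simp add: fin_quot_lconc fin_quot_conv_Id)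
qed

text \<open>The three-tape words carry the middle word explicitly; erasing that tape can leave trailing
  blank pairs, which are cut off by a right quotient.\<close>

lemma fin_quot_conv_relcomp:
  assumes "fin_quot (conv_lang R)" "fin_quot (conv_lang R')"
  shows "fin_quot (conv_lang (R O R'))"
proof -
  let ?bl = "(None, None) :: 'a option \<times> 'a option"
  let ?bls = "range (\<lambda>j. replicate j ?bl)"
  let ?h12 = "\<lambda>(a, b, c). (a, b) :: 'a option \<times> 'a option"
  let ?h23 = "\<lambda>(a, b, c). (b, c) :: 'a option \<times> 'a option"
  let ?h13 = "\<lambda>(a, b, c). (a, c) :: 'a option \<times> 'a option"
  define W where "W = {w. map ?h12 w \<in> lconc (conv_lang R) ?bls}
    \<inter> {w. map ?h23 w \<in> lconc (conv_lang R') ?bls}"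
  define M where "M = conv_lang UNIV \<inter> {w. \<exists>s\<in>?bls. w @ s \<in> map ?h13 ` W}"
  have padded: "v \<in> lconc (conv_lang Q) ?bls \<longleftrightarrow> (\<exists>\<alpha> \<beta>. (\<alpha>, \<beta>) \<in> Q \<and>
      max (length \<alpha>) (length \<beta>) \<le> length v \<and> v = conv_upto (length v) \<alpha> \<beta>)"
    (is "?l \<longleftrightarrow> ?r") for v and Q :: "('a list \<times> 'a list) set"
  proof
    assume ?l
    then obtain \<alpha> \<beta> j where *: "v = pad \<alpha> \<beta> @ replicate j ?bl" "(\<alpha>, \<beta>) \<in> Q"
      by (auto simp: lconc_def conv_lang_def)
    then have "length v = max (length \<alpha>) (length \<beta>) + j"
      by (simp add: pad_eq_conv_upto conv_upto_def)
    with * show ?r by (intro exI[of _ \<alpha>] exI[of _ \<beta>]) (simp add: conv_upto_eq_pad)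
  next
    assume ?r
    then obtain \<alpha> \<beta> where *: "(\<alpha>, \<beta>) \<in> Q" "max (length \<alpha>) (length \<beta>) \<le> length v"
        "v = conv_upto (length v) \<alpha> \<beta>"
      by blast
    then have "v = pad \<alpha> \<beta> @ replicate (length v - max (length \<alpha>) (length \<beta>)) ?bl"
      using conv_upto_eq_pad by metis
    with * show ?l unfolding lconc_def conv_lang_def by blast
  qed
  have "conv_lang (R O R') = M"
  proof (intro set_eqI iffI)
    fix w assume "w \<in> conv_lang (R O R')"
    then obtain \<alpha> \<beta> \<gamma> where w: "w = pad \<alpha> \<gamma>" and R: "(\<alpha>, \<beta>) \<in> R" "(\<beta>, \<gamma>) \<in> R'"
      by (auto simp: conv_lang_def)
    \<comment> \<open>Any common bound on the three lengths would do; the surplus positions are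
      blank on all tracks.\<close>
    define N where "N = length \<alpha> + length \<beta> + length \<gamma>"
    define t where "t = map (\<lambda>i. (opt_nth \<alpha> i, opt_nth \<beta> i, opt_nth \<gamma> i)) [0..<N]"
    have h: "map ?h12 t = conv_upto N \<alpha> \<beta>" "map ?h23 t = conv_upto N \<beta> \<gamma>"
        "map ?h13 t = conv_upto N \<alpha> \<gamma>"
      by (simp_all add: t_def conv_upto_def)
    have len: "length t = N" by (simp add: t_def)
    have "max (length \<alpha>) (length \<beta>) \<le> N" "max (length \<beta>) (length \<gamma>) \<le> N"
      by (simp_all add: N_def)
    then have "t \<in> W"
      unfolding W_def padded Int_iff mem_Collect_eq length_map len h using R by blast
    moreover have "map ?h13 t = w @ replicate (N - max (length \<alpha>) (length \<gamma>)) ?bl"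
      unfolding h w by (rule conv_upto_eq_pad) (simp add: N_def)
    ultimately have "w @ replicate (N - max (length \<alpha>) (length \<gamma>)) ?bl \<in> map ?h13 ` W"
      by (metis (no_types, lifting) imageI)
    then show "w \<in> M" unfolding M_def using w by (auto simp: conv_lang_def)
  next
    fix w assume "w \<in> M"
    then obtain \<alpha>' \<gamma>' j t where w: "w = pad \<alpha>' \<gamma>'" and t: "t \<in> W" "map ?h13 t = w @ replicate j ?bl"
      unfolding M_def conv_lang_def by (smt (verit) IntE imageE mem_Collect_eq rangeE)
    from t(1) obtain \<alpha> \<beta> where 12: "(\<alpha>, \<beta>) \<in> R" "max (length \<alpha>) (length \<beta>) \<le> length t"
        "map ?h12 t = conv_upto (length t) \<alpha> \<beta>"
      unfolding W_def padded by auto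
    from t(1) obtain \<beta>' \<gamma> where 23: "(\<beta>', \<gamma>) \<in> R'" "max (length \<beta>') (length \<gamma>) \<le> length t"
        "map ?h23 t = conv_upto (length t) \<beta>' \<gamma>"
      unfolding W_def padded by auto
    have nth12: "?h12 (t ! i) = (opt_nth \<alpha> i, opt_nth \<beta> i)" if "i < length t" for i
      using arg_cong[OF 12(3), of "\<lambda>l. l ! i"] that by (simp add: conv_upto_def)
    have nth23: "?h23 (t ! i) = (opt_nth \<beta>' i, opt_nth \<gamma> i)" if "i < length t" for i
      using arg_cong[OF 23(3), of "\<lambda>l. l ! i"] that by (simp add: conv_upto_def)
    \<comment> \<open>Within \<open>t\<close> both words are read off the same middle track, and
      beyond it both have ended.\<close>
    have mid: "opt_nth \<beta> i = opt_nth \<beta>' i" for i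
    proof (cases "i < length t")
      case True
      obtain a b c where "t ! i = (a, b, c)" by (cases "t ! i")
      then have "b = opt_nth \<beta> i" "b = opt_nth \<beta>' i"
        using nth12[OF True] nth23[OF True] by simp_all
      then show ?thesis by (rule subst)
    next
      case False
      then show ?thesis using 12(2) 23(2) by auto
    qed
    have "length \<beta> = length \<beta>'"
      using mid[of "length \<beta>"] mid[of "length \<beta>'"] by (auto split: if_splits)
    then have "\<beta> = \<beta>'"
      using mid by (intro nth_equalityI) (auto, metis option.inject)
    have "map ?h13 t = conv_upto (length t) \<alpha> \<gamma>"
    proof (rule nth_equalityI)
      fix i assume "i < length (map ?h13 t)"
      then show "map ?h13 t ! i = conv_upto (length t) \<alpha> \<gamma> ! i"
        using nth12[of i] nth23[of i] by (auto simp: conv_upto_def split: prod.splits)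
    qed (simp add: conv_upto_def)
    then have eq: "pad \<alpha>' \<gamma>' @ replicate j ?bl
        = pad \<alpha> \<gamma> @ replicate (length t - max (length \<alpha>) (length \<gamma>)) ?bl"
      using t(2) w 12(2) 23(2) by (simp add: conv_upto_eq_pad)
    have "pad \<alpha>' \<gamma>' = pad \<alpha> \<gamma>"
    proof -
      have blank: "\<And>i. List.map_filter fst (replicate i ?bl) = []"
        "\<And>i. List.map_filter snd (replicate i ?bl) = []"
        by (simp_all add: List.map_filter_def)
      show ?thesis
        using arg_cong[OF eq, of "List.map_filter fst"] arg_cong[OF eq, of "List.map_filter snd"]
        by (simp add: map_filter_append blank somes_fst_pad somes_snd_pad)
    qed
    then show "w \<in> conv_lang (R O R')"
      using w 12(1) 23(1) \<open>\<beta> = \<beta>'\<close> by (auto simp: conv_lang_def)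
  qed
  moreover have "fin_quot W"
    unfolding W_def using assms
    by (intro fin_quot_Int fin_quot_vimage_hom fin_quot_lconc fin_quot_replicate) auto
  then have "fin_quot M"
    unfolding M_def by (intro fin_quot_Int fin_quot_range_pad fin_quot_rquot fin_quot_image_map)
  ultimately show ?thesis by simp
qed

lemma pad_append:
  "length a = length a' \<Longrightarrow> pad (a @ b) (a' @ b') = pad a a' @ pad b b'"
  by (induction a a' rule: list_induct2) auto

lemma pad_replicate: "pad (replicate j b) (replicate j d) = replicate j (Some b, Some d)"
  by (induction j) auto

text \<open>Both sequences eventually gain exactly one letter per step. Their offset is therefore
  constant and can be absorbed into the fixed ends, leaving a single pumped pair (b, d).\<close>

lemma fin_quot_pad_pump:
  assumes f: "\<And>j. f (N + j) = D @ replicate j b @ q" and g: "\<And>j. g (N' + j) = D' @ replicate j d"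
  shows "fin_quot (range (\<lambda>m. pad (f m) (g m)))"
proof (rule fin_quot_eventually_pump)
  fix j
  \<comment> \<open>Besides passing both thresholds, the start leaves room to lengthen
    \<open>D\<close> by \<open>length D'\<close> letters and \<open>D'\<close> by
    \<open>length D\<close> letters, so that the pumped parts begin at the same position.\<close>
  let ?M = "N + N' + length D + length D'"
  let ?P = "D @ replicate (length D') b" and ?P' = "D' @ replicate (length D) d"
  let ?Q = "replicate (N' + length D) b @ q" and ?Q' = "replicate (N + length D') d"
  have "?M + j = N + (length D' + (j + (N' + length D)))" by simp
  then have "f (?M + j) = ?P @ replicate j b @ ?Q"
    by (simp only: f replicate_add append_assoc)
  moreover have "?M + j = N' + (length D + (j + (N + length D')))" by simp
  then have "g (?M + j) = ?P' @ replicate j d @ ?Q'"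
    by (simp only: g replicate_add append_assoc)
  ultimately show "pad (f (?M + j)) (g (?M + j)) = pad ?P ?P' @ replicate j (Some b, Some d) @ pad ?Q ?Q'"
    by (simp only: pad_append pad_replicate length_append length_replicate add.commute)
qed

section \<open>Automatic structures from coded words\<close>

lemma congr_gen_context:
  assumes "(v, w) \<in> congr_gen R"
  shows "(l @ v @ r, l @ w @ r) \<in> congr_gen R"
  using assms
proof induction
  case (base u v p q)
  then show ?case using congr_gen.base[of u v R "l @ p" "q @ r"] by simp
qed (auto intro: congr_gen.intros)

lemma congr_gen_append:
  assumes "(v, v') \<in> congr_gen R" "(w, w') \<in> congr_gen R"
  shows "(v @ w, v' @ w') \<in> congr_gen R"
  using congr_gen_context[OF assms(1), of "[]" w] congr_gen_context[OF assms(2), of v' "[]"]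
  by (auto intro: congr_gen.trans)

lemma congr_gen_minimal: "R \<subseteq> congr_gen R' \<Longrightarrow> congr_gen R \<subseteq> congr_gen R'"
proof
  fix p assume sub: "R \<subseteq> congr_gen R'" and p: "p \<in> congr_gen R"
  have "(v, w) \<in> congr_gen R'" if "(v, w) \<in> congr_gen R" for v w
    using that by induction (use sub in \<open>auto intro: congr_gen.intros congr_gen_context\<close>)
  then show "p \<in> congr_gen R'" using p by (cases p) simp
qed

lemma congr_gen_self: "(v, w) \<in> R \<Longrightarrow> (v, w) \<in> congr_gen R"
  using congr_gen.base[of v w R "[]" "[]"] by simp

lemma congr_gen_self_sym: "(v, w) \<in> R \<Longrightarrow> (w, v) \<in> congr_gen R"
  by (blast intro: congr_gen.sym congr_gen_self)

lemma cls_eq_iff: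
  assumes "v \<in> lists A" "w \<in> lists A"
  shows "cls A R v = cls A R w \<longleftrightarrow> (v, w) \<in> congr_gen R"
proof
  assume "cls A R v = cls A R w"
  moreover have "w \<in> cls A R w" using assms(2) by (simp add: cls_def congr_gen.refl)
  ultimately have "w \<in> cls A R v" by simp
  then show "(v, w) \<in> congr_gen R" by (simp add: cls_def)
next
  assume "(v, w) \<in> congr_gen R"
  then show "cls A R v = cls A R w"
    unfolding cls_def by (blast intro: congr_gen.trans congr_gen.sym)
qed

lemma sgp_mult_cls:
  assumes "v \<in> lists A" "w \<in> lists A"
  shows "sgp_mult A R (cls A R v) (cls A R w) = cls A R (v @ w)"
proof -
  have some: "(SOME x. x \<in> cls A R v) \<in> cls A R v" if "v \<in> lists A" for v
    by (rule someI[of _ v]) (simp add: cls_def congr_gen.refl that[simplified])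
  let ?v = "SOME x. x \<in> cls A R v" and ?w = "SOME x. x \<in> cls A R w"
  have "?v \<in> lists A" "(v, ?v) \<in> congr_gen R" "?w \<in> lists A" "(w, ?w) \<in> congr_gen R"
    using some[OF assms(1)] some[OF assms(2)] by (simp_all add: cls_def)
  then have "(?v @ ?w, v @ w) \<in> congr_gen R" "?v @ ?w \<in> lists A"
    by (auto intro: congr_gen_append congr_gen.sym)
  then show ?thesis unfolding sgp_mult_def using assms by (subst cls_eq_iff) auto
qed

lemma concat_in_lists: "\<alpha> \<in> lists B \<Longrightarrow> B \<subseteq> lists A \<Longrightarrow> concat \<alpha> \<in> lists A"
  by (induction \<alpha>) auto

lemma ev_map_cls:
  assumes "B \<subseteq> lists A" "\<alpha> \<in> lists B" "\<alpha> \<noteq> []"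
  shows "ev (sgp_mult A R) (map (cls A R) \<alpha>) = cls A R (concat \<alpha>)"
  using assms(2,3)
proof (induction \<alpha> rule: induct_list012)
  case (3 b c \<alpha>)
  then have "b \<in> lists A" "concat (c # \<alpha>) \<in> lists A"
    using assms(1) concat_in_lists[of "c # \<alpha>" B A] by auto
  then show ?case using 3 sgp_mult_cls[of b A "concat (c # \<alpha>)" R] by simp
qed auto

lemma pad_map: "pad (map f \<alpha>) (map f \<beta>) = map (map_prod (map_option f) (map_option f)) (pad \<alpha> \<beta>)"
  by (induction \<alpha> \<beta> rule: pad.induct) auto

lemma conv_lang_map:
  "conv_lang (map_prod (map f) (map f) ` Q)
    = map (map_prod (map_option f) (map_option f)) ` conv_lang Q"
proof (intro set_eqI iffI)
  fix v assume "v \<in> conv_lang (map_prod (map f) (map f) ` Q)"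
  then obtain \<alpha> \<beta> where "(\<alpha>, \<beta>) \<in> Q" "v = pad (map f \<alpha>) (map f \<beta>)"
    unfolding conv_lang_def by auto
  then show "v \<in> map (map_prod (map_option f) (map_option f)) ` conv_lang Q"
    unfolding pad_map conv_lang_def by blast
next
  fix v assume "v \<in> map (map_prod (map_option f) (map_option f)) ` conv_lang Q"
  then obtain \<alpha> \<beta> where "(\<alpha>, \<beta>) \<in> Q" "v = pad (map f \<alpha>) (map f \<beta>)"
    unfolding conv_lang_def by (auto simp: pad_map)
  then show "v \<in> conv_lang (map_prod (map f) (map f) ` Q)"
    unfolding conv_lang_def by force
qed

text \<open>The map \<open>f\<close> may identify code words; the hypothesis says that the relation
  is visible on the images, so nothing is lost by mapping it.\<close>

lemma pad_image_eq_conv_lang: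
  assumes "\<And>\<alpha> \<beta>. \<alpha> \<in> L \<Longrightarrow> \<beta> \<in> L \<Longrightarrow> P (f \<alpha>) (f \<beta>) \<longleftrightarrow> Q \<alpha> \<beta>"
  shows "{pad \<alpha> \<beta> | \<alpha> \<beta>. \<alpha> \<in> f ` L \<and> \<beta> \<in> f ` L \<and> P \<alpha> \<beta>}
    = conv_lang (map_prod f f ` {(\<alpha>, \<beta>). \<alpha> \<in> L \<and> \<beta> \<in> L \<and> Q \<alpha> \<beta>})"
  unfolding conv_lang_def using assms by (fastforce simp: map_prod_def)

lemma pad_in_pair_alph: "\<alpha> \<in> lists A \<Longrightarrow> \<beta> \<in> lists A \<Longrightarrow> pad \<alpha> \<beta> \<in> lists (pair_alph A)"
  by (induction \<alpha> \<beta> rule: pad.induct) (auto simp: pair_alph_def)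

text \<open>The factor \<open>w\<close> is a word, since the added block acts as a generator as
  well. Working with code words keeps letters apart that name the same class.\<close>

definition mult_rel :: "('a list \<times> 'a list) set \<Rightarrow> 'a list list set \<Rightarrow> 'a list
    \<Rightarrow> ('a list list \<times> 'a list list) set" where
  "mult_rel R L w = {(\<alpha>, \<beta>). \<alpha> \<in> L \<and> \<beta> \<in> L \<and> (concat \<alpha> @ w, concat \<beta>) \<in> congr_gen R}"

text \<open>The assumptions concern multiplication by letters of \<open>A\<close> only, even though
  \<open>B\<close> may contain longer words as generators.\<close>

locale word_coding =
  fixes A :: "'a set" and R :: "('a list \<times> 'a list) set" and B :: "'a list set"
    and L :: "'a list list set"
  assumes finite_B: "finite B" and B: "B \<subseteq> lists A - {[]}" and L: "L \<subseteq> lists B - {[]}"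
    and fin_quot_L: "fin_quot L"
    and represented: "\<And>w. w \<in> lists A \<Longrightarrow> w \<noteq> [] \<Longrightarrow> \<exists>\<alpha>\<in>L. (w, concat \<alpha>) \<in> congr_gen R"
    and fin_quot_eq: "fin_quot (conv_lang (mult_rel R L []))"
    and fin_quot_letter: "\<And>a. a \<in> A \<Longrightarrow> fin_quot (conv_lang (mult_rel R L [a]))"
begin

lemma concat_code: "\<alpha> \<in> L \<Longrightarrow> concat \<alpha> \<in> lists A" "\<alpha> \<in> L \<Longrightarrow> concat \<alpha> \<noteq> []"
proof -
  assume "\<alpha> \<in> L"
  then have "\<alpha> \<in> lists B" "\<alpha> \<noteq> []" using L by auto
  then show "concat \<alpha> \<in> lists A" using concat_in_lists[of \<alpha> B A] B by blast
  show "concat \<alpha> \<noteq> []" using \<open>\<alpha> \<in> lists B\<close> \<open>\<alpha> \<noteq> []\<close> B by (cases \<alpha>) auto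
qed

text \<open>By \<open>represented\<close>, the intermediate product also has a code word, which
  serves as the middle term of the composition.\<close>

lemma mult_rel_snoc:
  assumes "w \<in> lists A"
  shows "mult_rel R L (w @ [a]) = mult_rel R L w O mult_rel R L [a]"
proof (intro set_eqI iffI)
  fix p assume "p \<in> mult_rel R L (w @ [a])"
  then obtain \<alpha> \<beta> where p: "p = (\<alpha>, \<beta>)" "\<alpha> \<in> L" "\<beta> \<in> L"
      "(concat \<alpha> @ w @ [a], concat \<beta>) \<in> congr_gen R"
    by (auto simp: mult_rel_def)
  have "concat \<alpha> @ w \<in> lists A" "concat \<alpha> @ w \<noteq> []" using assms concat_code[OF p(2)] by auto
  from represented[OF this] obtain \<gamma> where \<gamma>: "\<gamma> \<in> L" "(concat \<alpha> @ w, concat \<gamma>) \<in> congr_gen R"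
    by blast
  then have "(concat \<gamma> @ [a], concat \<alpha> @ w @ [a]) \<in> congr_gen R"
    using congr_gen_append[OF congr_gen.sym[OF \<gamma>(2)] congr_gen.refl[of "[a]"]] by simp
  then have "(concat \<gamma> @ [a], concat \<beta>) \<in> congr_gen R" using p(4) by (rule congr_gen.trans)
  then show "p \<in> mult_rel R L w O mult_rel R L [a]"
    using p \<gamma> by (auto simp: mult_rel_def intro!: relcompI[of _ \<gamma>])
next
  fix p assume "p \<in> mult_rel R L w O mult_rel R L [a]"
  then obtain \<alpha> \<gamma> \<beta> where p: "p = (\<alpha>, \<beta>)" "\<alpha> \<in> L" "\<beta> \<in> L"
      "(concat \<alpha> @ w, concat \<gamma>) \<in> congr_gen R" "(concat \<gamma> @ [a], concat \<beta>) \<in> congr_gen R"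
    by (auto simp: mult_rel_def)
  have "(concat \<alpha> @ w @ [a], concat \<gamma> @ [a]) \<in> congr_gen R"
    using congr_gen_append[OF p(4) congr_gen.refl[of "[a]"]] by simp
  then have "(concat \<alpha> @ w @ [a], concat \<beta>) \<in> congr_gen R" using p(5) by (rule congr_gen.trans)
  then show "p \<in> mult_rel R L (w @ [a])" using p by (simp add: mult_rel_def)
qed

lemma fin_quot_mult_rel: "w \<in> lists A \<Longrightarrow> fin_quot (conv_lang (mult_rel R L w))"
proof (induction w rule: rev_induct)
  case Nil
  show ?case by (rule fin_quot_eq)
next
  case (snoc a w)
  then show ?case using fin_quot_letter by (simp add: mult_rel_snoc fin_quot_conv_relcomp)
qed

lemma regular_mult_rel:
  assumes "w \<in> lists A"
  shows "regular (pair_alph (cls A R ` B)) (conv_lang (map_prod (map (cls A R)) (map (cls A R)) ` mult_rel R L w))"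
proof (rule regular_if_fin_quot)
  have "conv_lang (map_prod (map (cls A R)) (map (cls A R)) ` mult_rel R L w)
      = map (map_prod (map_option (cls A R)) (map_option (cls A R))) ` conv_lang (mult_rel R L w)"
    by (rule conv_lang_map)
  then show "fin_quot (conv_lang (map_prod (map (cls A R)) (map (cls A R)) ` mult_rel R L w))"
    using fin_quot_mult_rel[OF assms] by (simp add: fin_quot_image_map)
  show "conv_lang (map_prod (map (cls A R)) (map (cls A R)) ` mult_rel R L w)
      \<subseteq> lists (pair_alph (cls A R ` B))"
  proof
    fix v assume "v \<in> conv_lang (map_prod (map (cls A R)) (map (cls A R)) ` mult_rel R L w)"
    then obtain \<alpha> \<beta> where "\<alpha> \<in> L" "\<beta> \<in> L" "v = pad (map (cls A R) \<alpha>) (map (cls A R) \<beta>)"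
      by (auto simp: conv_lang_def mult_rel_def)
    moreover have "map (cls A R) \<gamma> \<in> lists (cls A R ` B)" if "\<gamma> \<in> L" for \<gamma>
      using that L by (auto simp: lists_image)
    ultimately show "v \<in> lists (pair_alph (cls A R ` B))" by (simp add: pad_in_pair_alph del: in_lists_conv_set)
  qed
qed

lemma ev_code: "\<alpha> \<in> L \<Longrightarrow> ev (sgp_mult A R) (map (cls A R) \<alpha>) = cls A R (concat \<alpha>)"
  using B L by (intro ev_map_cls[of B]) auto

lemma auto_structure_code:
  "auto_structure (sgp_carrier A R) (sgp_mult A R) (cls A R ` B) (map (cls A R) ` L)"
proof -
  let ?c = "cls A R" and ?m = "sgp_mult A R"
  have lists: "map ?c ` L \<subseteq> lists (?c ` B) - {[]}"
    using L by (auto simp: lists_image)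
  have carrier: "ev ?m ` map ?c ` L = sgp_carrier A R"
  proof (intro set_eqI iffI)
    fix X assume "X \<in> ev ?m ` map ?c ` L"
    then show "X \<in> sgp_carrier A R"
      using concat_code by (auto simp: ev_code sgp_carrier_def simp del: in_lists_conv_set)
  next
    fix X assume "X \<in> sgp_carrier A R"
    then obtain w where w: "w \<in> lists A" "w \<noteq> []" "X = ?c w" by (auto simp: sgp_carrier_def)
    from represented[OF w(1,2)] obtain \<alpha> where "\<alpha> \<in> L" "(w, concat \<alpha>) \<in> congr_gen R" by blast
    then have "X = ev ?m (map ?c \<alpha>)"
      using w cls_eq_iff[OF w(1) concat_code(1)] by (simp add: ev_code)
    with \<open>\<alpha> \<in> L\<close> show "X \<in> ev ?m ` map ?c ` L" by blast
  qed
  have eq: "{pad \<alpha> \<beta> | \<alpha> \<beta>. \<alpha> \<in> map ?c ` L \<and> \<beta> \<in> map ?c ` L \<and> ev ?m \<alpha> = ev ?m \<beta>}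
      = conv_lang (map_prod (map ?c) (map ?c) ` mult_rel R L [])"
  proof -
    have "ev ?m (map ?c \<alpha>) = ev ?m (map ?c \<beta>) \<longleftrightarrow> (concat \<alpha>, concat \<beta>) \<in> congr_gen R"
      if "\<alpha> \<in> L" "\<beta> \<in> L" for \<alpha> \<beta>
      using that concat_code(1) by (simp add: ev_code cls_eq_iff del: in_lists_conv_set)
    then show ?thesis unfolding mult_rel_def append_Nil2 by (rule pad_image_eq_conv_lang)
  qed
  have mul: "{pad \<alpha> \<beta> | \<alpha> \<beta>. \<alpha> \<in> map ?c ` L \<and> \<beta> \<in> map ?c ` L \<and> ev ?m (\<alpha> @ [?c b]) = ev ?m \<beta>}
      = conv_lang (map_prod (map ?c) (map ?c) ` mult_rel R L b)" if b: "b \<in> B" for b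
  proof -
    have "ev ?m (map ?c \<alpha> @ [?c b]) = ev ?m (map ?c \<beta>) \<longleftrightarrow> (concat \<alpha> @ b, concat \<beta>) \<in> congr_gen R"
      if "\<alpha> \<in> L" "\<beta> \<in> L" for \<alpha> \<beta>
    proof -
      have "ev ?m (map ?c (\<alpha> @ [b])) = ?c (concat (\<alpha> @ [b]))"
        using B L b that by (intro ev_map_cls[of B]) auto
      moreover have "concat \<alpha> @ b \<in> lists A" using concat_code(1)[OF that(1)] B b by auto
      ultimately show ?thesis
        using that concat_code(1) by (simp add: ev_code cls_eq_iff del: in_lists_conv_set)
    qed
    then show ?thesis unfolding mult_rel_def by (rule pad_image_eq_conv_lang)
  qed
  have "?c ` B \<subseteq> sgp_carrier A R" using B by (auto simp: sgp_carrier_def)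
  moreover have "regular (?c ` B) (map ?c ` L)"
    using lists fin_quot_L by (intro regular_if_fin_quot fin_quot_image_map) auto
  moreover have "\<forall>X\<in>?c ` B. regular (pair_alph (?c ` B)) {pad \<alpha> \<beta> | \<alpha> \<beta>.
      \<alpha> \<in> map ?c ` L \<and> \<beta> \<in> map ?c ` L \<and> ev ?m (\<alpha> @ [X]) = ev ?m \<beta>}"
  proof
    fix X assume "X \<in> ?c ` B"
    then obtain b where b: "b \<in> B" "X = ?c b" by blast
    show "regular (pair_alph (?c ` B)) {pad \<alpha> \<beta> | \<alpha> \<beta>.
        \<alpha> \<in> map ?c ` L \<and> \<beta> \<in> map ?c ` L \<and> ev ?m (\<alpha> @ [X]) = ev ?m \<beta>}"
      unfolding b(2) mul[OF b(1)] using B b(1) by (intro regular_mult_rel) auto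
  qed
  ultimately show ?thesis
    unfolding auto_structure_def eq
    using lists carrier finite_B regular_mult_rel[of "[]"] by simp
qed

text \<open>For a prefix-closed set of code words, nonempty prefixes are code words again, and the
  additional language is just the equality language.\<close>

lemma prefix_automatic_code:
  assumes "\<And>\<alpha> \<beta>. \<alpha> @ \<beta> \<in> L \<Longrightarrow> \<alpha> \<noteq> [] \<Longrightarrow> \<alpha> \<in> L"
  shows "prefix_automatic (sgp_carrier A R) (sgp_mult A R)"
proof -
  let ?L = "map (cls A R) ` L" and ?m = "sgp_mult A R"
  have pref: "\<beta> \<in> Pref ?L \<and> \<beta> \<noteq> [] \<longleftrightarrow> \<beta> \<in> ?L" for \<beta>
  proof
    assume "\<beta> \<in> Pref ?L \<and> \<beta> \<noteq> []"
    then show "\<beta> \<in> ?L"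
      using assms by (fastforce simp: Pref_def append_eq_map_conv)
  next
    assume "\<beta> \<in> ?L"
    then show "\<beta> \<in> Pref ?L \<and> \<beta> \<noteq> []" using L by (auto simp: Pref_def intro: exI[of _ "[]"])
  qed
  have drop: "\<beta> \<in> Pref ?L \<and> \<beta> \<noteq> [] \<and> Q \<longleftrightarrow> \<beta> \<in> ?L \<and> Q" for \<beta> Q
    using pref[of \<beta>] by blast
  have "regular (pair_alph (cls A R ` B))
      {pad \<alpha> \<beta> | \<alpha> \<beta>. \<alpha> \<in> ?L \<and> \<beta> \<in> Pref ?L \<and> \<beta> \<noteq> [] \<and> ev ?m \<alpha> = ev ?m \<beta>}"
    unfolding drop using auto_structure_code unfolding auto_structure_def by (elim conjE)
  then show ?thesis
    unfolding prefix_automatic_def using auto_structure_code by blast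
qed

end

section \<open>Unique normal forms from a one-element basis\<close>

definition rstep :: "'a list \<Rightarrow> 'a list \<Rightarrow> ('a list \<times> 'a list) set" where
  "rstep U V = {(l @ U @ r, l @ V @ r) | l r. True}"

text \<open>Connectedness below \<open>w\<close>: steps may be used in both directions, but the
  larger word of each step is smaller than \<open>w\<close>. This matches the bound on the summands
  in a triviality certificate, which in itself provides no common reduct.\<close>

definition rconn :: "(nat \<Rightarrow> nat) \<Rightarrow> nat list \<Rightarrow> nat list \<Rightarrow> nat list \<Rightarrow> (nat list \<times> nat list) set" where
  "rconn \<rho> U V w = (let E = {(p, q) \<in> rstep U V. dlex_less \<rho> p w} in (E \<union> E\<inverse>)\<^sup>*)"

lemma dlex_less_lenlex: "dlex_less \<rho> v w \<longleftrightarrow> (v, w) \<in> lenlex (measure \<rho>)"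
proof -
  have "{(a, b). \<rho> a < \<rho> b} = measure \<rho>" by auto
  then show ?thesis by (auto simp: dlex_less_def lenlex_conv lexord_lex)
qed

lemma wf_dlex_less: "wf {(v, w). dlex_less \<rho> v w}"
  using wf_lenlex[OF wf_measure[of \<rho>]] by (simp add: dlex_less_lenlex)

lemma dlex_less_trans: "dlex_less \<rho> u v \<Longrightarrow> dlex_less \<rho> v w \<Longrightarrow> dlex_less \<rho> u w"
  unfolding dlex_less_lenlex by (erule (1) lenlex_trans) (auto intro: transI)

lemma dlex_less_asym: "dlex_less \<rho> v w \<Longrightarrow> \<not> dlex_less \<rho> w v"
  using wf_asym[OF wf_dlex_less[of \<rho>], of v w] by simp

lemma dlex_less_context:
  assumes "dlex_less \<rho> v w" shows "dlex_less \<rho> (l @ v @ r) (l @ w @ r)"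
proof (cases "length v < length w")
  case False
  then have "length v = length w" "(v, w) \<in> lexord {(a, b). \<rho> a < \<rho> b}"
    using assms by (auto simp: dlex_less_def)
  then show ?thesis
    by (auto simp: dlex_less_def intro!: lexord_append_leftI lexord_sufI)
qed (simp add: dlex_less_def)

lemma rstep_context: "(p, q) \<in> rstep U V \<Longrightarrow> (l @ p @ r, l @ q @ r) \<in> rstep U V"
  unfolding rstep_def by clarify (metis append.assoc)

lemma rstep_less: "dlex_less \<rho> V U \<Longrightarrow> (p, q) \<in> rstep U V \<Longrightarrow> dlex_less \<rho> q p"
  unfolding rstep_def by (auto intro: dlex_less_context)

lemma rconn_sym: "(p, q) \<in> rconn \<rho> U V w \<Longrightarrow> (q, p) \<in> rconn \<rho> U V w"
proof -
  have "sym (rconn \<rho> U V w)" unfolding rconn_def Let_def by (intro sym_rtrancl sym_Un_converse)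
  then show "(p, q) \<in> rconn \<rho> U V w \<Longrightarrow> (q, p) \<in> rconn \<rho> U V w" by (rule symD)
qed

lemma rconn_trans: "(p, q) \<in> rconn \<rho> U V w \<Longrightarrow> (q, r) \<in> rconn \<rho> U V w \<Longrightarrow> (p, r) \<in> rconn \<rho> U V w"
  unfolding rconn_def Let_def by (rule rtrancl_trans)

lemma rconn_step: "(p, q) \<in> rstep U V \<Longrightarrow> dlex_less \<rho> p w \<Longrightarrow> (p, q) \<in> rconn \<rho> U V w"
  unfolding rconn_def Let_def by auto

lemma rconn_induct [consumes 1, case_names refl step]:
  assumes "(p, q) \<in> rconn \<rho> U V w" and "P p"
    and "\<And>q r. P q \<Longrightarrow> (q, r) \<in> rstep U V \<and> dlex_less \<rho> q w \<or> (r, q) \<in> rstep U V \<and> dlex_less \<rho> r w \<Longrightarrow> P r"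
  shows "P q"
  using assms(1) unfolding rconn_def Let_def
  by (induction rule: rtrancl_induct) (use assms in auto)

lemma rconn_context:
  assumes "(p, q) \<in> rconn \<rho> U V w"
  shows "(l @ p @ r, l @ q @ r) \<in> rconn \<rho> U V (l @ w @ r)"
  using assms
proof (induction rule: rconn_induct)
  case refl
  show ?case by (simp add: rconn_def Let_def)
next
  case (step s t)
  have "(l @ s @ r, l @ t @ r) \<in> rconn \<rho> U V (l @ w @ r)"
    using step(2) by (auto intro: rconn_sym rconn_step rstep_context dlex_less_context)
  with step(1) show ?case by (rule rconn_trans)
qed

lemma append_eq_append_prefixE:
  assumes "a @ b = c @ d" "length a \<le> length c"
  obtains m where "c = a @ m" "b = m @ d"
proof -
  have "c = a @ drop (length a) c" "b = drop (length a) c @ d"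
    using arg_cong[OF assms(1), of "take (length a)"] arg_cong[OF assms(1), of "drop (length a)"] assms(2)
    by (simp_all, metis append_take_drop_id)
  then show ?thesis by (rule that)
qed

text \<open>These are all critical pairs of a single rule: an inclusion of \<open>U\<close> in
  itself is the case where \<open>a\<close> and \<open>b\<close> are empty.\<close>

definition overlaps_trivial :: "(nat \<Rightarrow> nat) \<Rightarrow> nat list \<Rightarrow> nat list \<Rightarrow> bool" where
  "overlaps_trivial \<rho> U V \<longleftrightarrow> (\<forall>a b. U @ b = a @ U \<longrightarrow> length b < length U \<longrightarrow>
     (a @ V, V @ b) \<in> rconn \<rho> U V (U @ b))"

text \<open>Disjoint redexes have a common reduct, reached by steps that start below
  \<open>w\<close>; overlapping ones are a critical pair placed in a context.\<close>

lemma rstep_rconn: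
  assumes less: "dlex_less \<rho> V U" and triv: "overlaps_trivial \<rho> U V"
    and "(w, p) \<in> rstep U V" "(w, q) \<in> rstep U V"
  shows "(p, q) \<in> rconn \<rho> U V w"
proof -
  have *: "(l1 @ V @ r1, l2 @ V @ r2) \<in> rconn \<rho> U V (l1 @ U @ r1)"
    if eq: "l1 @ U @ r1 = l2 @ U @ r2" and le: "length l1 \<le> length l2" for l1 r1 l2 r2
  proof -
    obtain m where m: "l2 = l1 @ m" "U @ r1 = m @ U @ r2"
      using append_eq_append_prefixE[OF eq le] .
    show ?thesis
    proof (cases "length U \<le> length m")
      case True
      obtain m' where m': "m = U @ m'" "r1 = m' @ U @ r2"
        using append_eq_append_prefixE[OF m(2) True] .
      let ?c = "l1 @ V @ m' @ V @ r2"
      have "(l1 @ V @ r1, ?c) = ((l1 @ V @ m') @ U @ r2, (l1 @ V @ m') @ V @ r2)"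
        "(l2 @ V @ r2, ?c) = (l1 @ U @ (m' @ V @ r2), l1 @ V @ (m' @ V @ r2))"
        unfolding m(1) m' by simp_all
      then have "(l1 @ V @ r1, ?c) \<in> rstep U V" "(l2 @ V @ r2, ?c) \<in> rstep U V"
        unfolding rstep_def by blast+
      moreover have "dlex_less \<rho> (l1 @ V @ r1) (l1 @ U @ r1)" "dlex_less \<rho> (l2 @ V @ r2) (l1 @ U @ r1)"
        using dlex_less_context[OF less, of l1 r1] dlex_less_context[OF less, of l2 r2] eq
        by simp_all
      ultimately show ?thesis by (blast intro: rconn_step rconn_sym rconn_trans)
    next
      case False
      have "U @ r1 = (m @ U) @ r2" using m(2) by simp
      then obtain b where b: "m @ U = U @ b" "r1 = b @ r2"
        by (rule append_eq_append_prefixE) simp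
      have "length b = length m" using arg_cong[OF b(1), of length] by simp
      then have "(m @ V, V @ b) \<in> rconn \<rho> U V (U @ b)"
        using triv b(1)[symmetric] False unfolding overlaps_trivial_def by auto
      from rconn_sym[OF rconn_context[OF this, of l1 r2]] show ?thesis by (simp add: m b)
    qed
  qed
  obtain l1 r1 l2 r2 where w: "w = l1 @ U @ r1" "p = l1 @ V @ r1" "w = l2 @ U @ r2" "q = l2 @ V @ r2"
    using assms(3,4) unfolding rstep_def by blast
  show ?thesis
  proof (cases "length l1 \<le> length l2")
    case True
    then show ?thesis using *[of l1 r1 l2 r2] w by simp
  next
    case False
    then show ?thesis using *[of l2 r2 l1 r1] w by (simp add: rconn_sym)
  qed
qed

definition irr :: "'a list \<Rightarrow> 'a list \<Rightarrow> bool" where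
  "irr U w \<longleftrightarrow> \<not> sublist U w"

lemma irr_iff: "irr U w \<longleftrightarrow> (\<forall>q. (w, q) \<notin> rstep U V)"
  by (auto simp: irr_def sublist_def rstep_def)

text \<open>Induction along the deg-lex ordering. Below \<open>w\<close> normal forms are already
  unique, hence constant along every connection below \<open>w\<close>; two one-step reducts of
  \<open>w\<close> are so connected and share their normal form.\<close>

lemma ex1_normal_form:
  assumes less: "dlex_less \<rho> V U" and triv: "overlaps_trivial \<rho> U V"
  shows "\<exists>!n. (w, n) \<in> (rstep U V)\<^sup>* \<and> irr U n"
  using wf_dlex_less[of \<rho>]
proof (induction w rule: wf_induct_rule)
  case (less w)
  define nf where "nf w = (THE n. (w, n) \<in> (rstep U V)\<^sup>* \<and> irr U n)" for w
  have ex1: "\<exists>!n. (v, n) \<in> (rstep U V)\<^sup>* \<and> irr U n" if "dlex_less \<rho> v w" for v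
    using less that by simp
  have nf: "(v, nf v) \<in> (rstep U V)\<^sup>*" "irr U (nf v)" if "dlex_less \<rho> v w" for v
    unfolding nf_def using theI'[OF ex1[OF that]] by blast+
  have nf_eq: "nf v = n" if "dlex_less \<rho> v w" "(v, n) \<in> (rstep U V)\<^sup>*" "irr U n" for v n
    using ex1[OF that(1)] nf[OF that(1)] that(2,3) by blast
  have down: "dlex_less \<rho> q w" if "(p, q) \<in> rstep U V" "p = w \<or> dlex_less \<rho> p w" for p q
    using rstep_less[OF assms(1) that(1)] that(2) dlex_less_trans by blast
  have nf_step: "nf p = nf q" if "(p, q) \<in> rstep U V" "dlex_less \<rho> p w" for p q
    using nf_eq[OF that(2)] nf[OF down] that by (metis converse_rtrancl_into_rtrancl)
  have nf_conn: "nf p = nf q" if "(p, q) \<in> rconn \<rho> U V w" for p q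
    using that by (induction rule: rconn_induct) (auto simp: nf_step)
  show ?case
  proof (cases "irr U w")
    case True
    then have "n = w" if "(w, n) \<in> (rstep U V)\<^sup>*" for n
      using that irr_iff[of U w V] by (metis converse_rtranclE)
    with True show ?thesis by blast
  next
    case False
    then obtain p where p: "(w, p) \<in> rstep U V" using irr_iff[of U w V] by blast
    have pw: "dlex_less \<rho> p w" using down[OF p] by simp
    show ?thesis
    proof (rule ex1I[of _ "nf p"])
      show "(w, nf p) \<in> (rstep U V)\<^sup>* \<and> irr U (nf p)"
        using nf[OF pw] p by (blast intro: converse_rtrancl_into_rtrancl)
      fix n assume n: "(w, n) \<in> (rstep U V)\<^sup>* \<and> irr U n"
      then have "n \<noteq> w" using False by auto
      with n obtain q where q: "(w, q) \<in> rstep U V" "(q, n) \<in> (rstep U V)\<^sup>*"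
        by (metis converse_rtranclE)
      have "nf q = n" using nf_eq[OF down[OF q(1)]] q(2) n by blast
      moreover have "nf p = nf q" using rstep_rconn[OF assms p q(1)] by (rule nf_conn)
      ultimately show "n = nf p" by simp
    qed
  qed
qed

lemma rstep_congr: "(p, q) \<in> (rstep U V)\<^sup>* \<Longrightarrow> (p, q) \<in> congr_gen {(U, V)}"
  by (induction rule: rtrancl_induct)
    (auto simp: rstep_def intro: congr_gen.intros)

lemma irr_unique:
  assumes "dlex_less \<rho> V U" "overlaps_trivial \<rho> U V"
    and "(p, q) \<in> congr_gen {(U, V)}" "irr U p" "irr U q"
  shows "p = q"
proof -
  define nf where "nf w = (THE n. (w, n) \<in> (rstep U V)\<^sup>* \<and> irr U n)" for w
  note ex1 = ex1_normal_form[OF assms(1,2)]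
  have nf: "(w, nf w) \<in> (rstep U V)\<^sup>*" "irr U (nf w)" for w
    unfolding nf_def using theI'[OF ex1] by blast+
  have nf_eq: "nf w = n" if "(w, n) \<in> (rstep U V)\<^sup>*" "irr U n" for w n
    using ex1[of w] nf[of w] that by blast
  have "nf p = nf q"
    using assms(3)
  proof induction
    case (base u v l r)
    then have "(l @ u @ r, l @ v @ r) \<in> rstep U V" by (auto simp: rstep_def)
    then show ?case using nf_eq nf by (metis converse_rtrancl_into_rtrancl)
  qed auto
  moreover have "nf p = p" "nf q = q" using nf_eq assms(4,5) by blast+
  ultimately show ?thesis by simp
qed

lemma irr_exists:
  assumes "dlex_less \<rho> V U" "overlaps_trivial \<rho> U V"
  shows "\<exists>n. (w, n) \<in> congr_gen {(U, V)} \<and> irr U n"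
  using ex1_normal_form[OF assms, of w] rstep_congr by blast

section \<open>From trivial compositions to connected overlaps\<close>

lemma wmul_binomial:
  assumes "f = (\<lambda>w. c * ((if w = U then 1 else 0) - (if w = V then 1 else 0)))"
  shows "wmul a f b w = c * ((if w = a @ U @ b then 1 else 0) - (if w = a @ V @ b then 1 else 0))"
proof (cases "\<exists>v. w = a @ v @ b")
  case True
  then obtain v where v: "w = a @ v @ b" by blast
  then have "(THE v. w = a @ v @ b) = v" by auto
  then show ?thesis using v by (auto simp: wmul_def assms)
qed (auto simp: wmul_def assms)

text \<open>Summing coefficients over the connected component of \<open>p\<close> annihilates the right-hand
  side of a triviality certificate, but not \<open>p - q\<close> unless \<open>q\<close> lies in that component.\<close>

lemma trivial_mod_rconn:
  fixes c :: "'k::field"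
  assumes f: "f = (\<lambda>w. c * ((if w = U then 1 else 0) - (if w = V then 1 else 0)))" and c: "c \<noteq> 0"
    and lead: "lead \<rho> f = U"
    and triv: "trivial_mod \<rho> A {f} w h"
    and h: "\<And>v. h v = c * ((if v = p then 1 else 0) - (if v = q then 1 else 0))"
  shows "(p, q) \<in> rconn \<rho> U V w"
proof (rule ccontr)
  assume nconn: "(p, q) \<notin> rconn \<rho> U V w"
  obtain m :: nat and \<alpha> :: "nat \<Rightarrow> 'k" and a s b where
    s': "\<forall>i<m. s i = f \<and> a i \<in> lists A \<and> b i \<in> lists A \<and>
        dlex_less \<rho> (a i @ lead \<rho> (s i) @ b i) w"
    and sum: "\<forall>v. h v = (\<Sum>i<m. \<alpha> i * wmul (a i) (s i) (b i) v)"
    using triv unfolding trivial_mod_def singleton_iff by (elim exE conjE)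
  have s: "s i = f \<and> dlex_less \<rho> (a i @ lead \<rho> (s i) @ b i) w" if "i < m" for i
    using s' that by blast
  define C where "C = {v. (p, v) \<in> rconn \<rho> U V w}"
  \<comment> \<open>Every word with a nonzero coefficient in \<open>h\<close> or in a summand lies
    in \<open>W\<close>, which makes the sum over the component finite.\<close>
  define W where "W = {p, q} \<union> (\<lambda>i. a i @ U @ b i) ` {..<m} \<union> (\<lambda>i. a i @ V @ b i) ` {..<m}"
  have fin: "finite (W \<inter> C)" by (simp add: W_def)
  have ind: "(\<Sum>v\<in>W \<inter> C. c * ((if v = r then 1 else 0) - (if v = t then 1 else 0)))
      = c * ((if r \<in> C then 1 else 0) - (if t \<in> C then 1 else 0))" if "r \<in> W" "t \<in> W" for r t
    using that by (simp add: sum_distrib_left[symmetric] sum_subtractf sum.delta[OF fin])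
  have "(\<Sum>v\<in>W \<inter> C. wmul (a i) (s i) (b i) v) = 0" if "i < m" for i
  proof -
    have st: "(a i @ U @ b i, a i @ V @ b i) \<in> rconn \<rho> U V w"
      using s[OF that] lead by (intro rconn_step) (auto simp: rstep_def)
    then have "a i @ U @ b i \<in> C \<longleftrightarrow> a i @ V @ b i \<in> C"
      unfolding C_def using rconn_trans rconn_sym by blast
    moreover have "a i @ U @ b i \<in> W" "a i @ V @ b i \<in> W" using that by (auto simp: W_def)
    ultimately show ?thesis using s[OF that] by (simp add: wmul_binomial[OF f] ind)
  qed
  then have "(\<Sum>v\<in>W \<inter> C. h v) = 0"
    unfolding sum[rule_format] by (subst sum.swap) (simp add: sum_distrib_left[symmetric])
  moreover have "(\<Sum>v\<in>W \<inter> C. h v) = c"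
  proof -
    have "p \<in> C" "q \<notin> C" using nconn by (auto simp: C_def rconn_def Let_def)
    then show ?thesis unfolding h by (subst ind) (auto simp: W_def)
  qed
  ultimately show False using c by simp
qed

lemma is_lead_unique: "is_lead \<rho> f v \<Longrightarrow> is_lead \<rho> f w \<Longrightarrow> v = w"
  unfolding is_lead_def using dlex_less_asym by metis

lemma lead_eq: "is_lead \<rho> f w \<Longrightarrow> lead \<rho> f = w"
  unfolding lead_def using is_lead_unique by blast

text \<open>The scalar \<open>c\<close> is 1 or -1, according to which monomial of the given
  binomial leads; \<open>U\<close> always denotes the leading one.\<close>

lemma GSB_binomial_overlaps:
  fixes c :: "'k::field"
  assumes f: "f = (\<lambda>w. c * ((if w = U then 1 else 0) - (if w = V then 1 else 0)))" and c: "c \<noteq> 0"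
    and lead: "is_lead \<rho> f U" and G: "GSB \<rho> A {f}" and U: "U \<in> lists A"
  shows "overlaps_trivial \<rho> U V"
  unfolding overlaps_trivial_def
proof (intro allI impI)
  fix a b assume eq: "U @ b = a @ U" and len: "length b < length U"
  have la: "length a = length b" using arg_cong[OF eq, of length] by simp
  \<comment> \<open>As factors of \<open>U\<close> the words \<open>a\<close> and \<open>b\<close>
    lie over \<open>A\<close>, as the definition of a composition demands.\<close>
  then have "a = take (length b) U" "b = drop (length U - length b) U"
    using arg_cong[OF eq, of "take (length b)"] arg_cong[OF eq, of "drop (length U)"] len by simp_all
  then have "set a \<subseteq> set U" "set b \<subseteq> set U" by (metis set_take_subset, metis set_drop_subset)
  then have "a \<in> lists A" "b \<in> lists A" using U by auto
  moreover have "U @ b = lead \<rho> f @ b \<and> U @ b = a @ lead \<rho> f \<and>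
      length (U @ b) < length (lead \<rho> f) + length (lead \<rho> f)"
    using eq len la lead_eq[OF lead] by simp
  ultimately have "trivial_mod \<rho> A {f} (U @ b) (\<lambda>v. wmul [] f b v - wmul a f [] v)"
    using G unfolding GSB_def by blast
  \<comment> \<open>The overlap word \<open>U @ b = a @ U\<close> cancels in the composition, and
    \<open>c\<close> times the difference of \<open>a @ V\<close> and \<open>V @ b\<close>
    remains.\<close>
  then show "(a @ V, V @ b) \<in> rconn \<rho> U V (U @ b)"
    by (rule trivial_mod_rconn[OF f c lead_eq[OF lead]])
      (simp add: wmul_binomial[OF f] eq algebra_simps)
qed

text \<open>Monicity supplies a leading word, so the binomial is nonzero and \<open>u\<close>
  differs from \<open>v\<close>; the ordering then depends on which of the two is leading.\<close>

lemma GSB_binomial: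
  fixes f :: "nat list \<Rightarrow> 'k::field"
  assumes f: "f = (\<lambda>w. (if w = u then 1 else 0) - (if w = v then 1 else 0))"
    and G: "GSB \<rho> A {f}" and "u \<in> lists A" "v \<in> lists A"
  shows "dlex_less \<rho> v u \<and> overlaps_trivial \<rho> u v \<or> dlex_less \<rho> u v \<and> overlaps_trivial \<rho> v u"
proof -
  obtain w where w: "is_lead \<rho> f w" using G by (auto simp: GSB_def monic_def)
  then have "u \<noteq> v" "w = u \<or> w = v" by (auto simp: f is_lead_def split: if_splits)
  then have "f u \<noteq> 0" "f v \<noteq> 0" by (auto simp: f)
  from \<open>w = u \<or> w = v\<close> show ?thesis
  proof
    assume "w = u"
    then have "dlex_less \<rho> v u" using w \<open>f v \<noteq> 0\<close> \<open>u \<noteq> v\<close> by (auto simp: is_lead_def)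
    moreover have "overlaps_trivial \<rho> u v"
      by (rule GSB_binomial_overlaps[of f 1]) (use f G w \<open>w = u\<close> assms in auto)
    ultimately show ?thesis by blast
  next
    assume "w = v"
    then have "dlex_less \<rho> u v" using w \<open>f u \<noteq> 0\<close> \<open>u \<noteq> v\<close> by (auto simp: is_lead_def)
    moreover have "overlaps_trivial \<rho> v u"
      by (rule GSB_binomial_overlaps[of f "-1"]) (use f G w \<open>w = v\<close> assms in auto)
    ultimately show ?thesis by blast
  qed
qed

lemma irr_snoc: "irr U (w @ [a]) \<longleftrightarrow> irr U w \<and> \<not> suffix U (w @ [a])"
proof -
  have "sublist U (w @ [a]) \<longleftrightarrow> sublist U w \<or> suffix U (w @ [a])" (is "?l \<longleftrightarrow> ?r")
  proof
    assume ?l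
    then obtain l r where lr: "w @ [a] = l @ U @ r" by (auto simp: sublist_def)
    show ?r
    proof (cases r rule: rev_cases)
      case Nil
      then show ?thesis using lr by (simp add: suffix_def)
    next
      case (snoc r' b)
      then have "w = l @ U @ r'" using lr by simp
      then show ?thesis by (auto simp: sublist_def)
    qed
  next
    assume ?r
    then show ?l by (auto simp: sublist_def suffix_def) (blast, metis append_Nil2)
  qed
  then show ?thesis by (auto simp: irr_def)
qed

lemma irr_prefix: "irr U (v @ w) \<Longrightarrow> irr U v"
  unfolding irr_def sublist_def by (metis append.assoc)

lemma fin_quot_irr: "fin_quot {w. irr U w}"
proof -
  have "{w. irr U w} = - lconc UNIV (lconc {U} UNIV)"
    by (auto simp: irr_def sublist_def lconc_def)
  then show ?thesis by (simp add: fin_quot_Compl fin_quot_lconc fin_quot_singleton)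
qed

lemma suffix_two_letters:
  assumes "suffix U (z @ [a, b])" "2 \<le> length U"
  shows "drop (length U - 2) U = [a, b]"
proof -
  have "suffix [a, b] (z @ [a, b])" by (simp add: suffix_def)
  then have "suffix [a, b] U" using assms by (auto intro: suffix_length_suffix)
  then show ?thesis by (auto simp: suffix_def)
qed

text \<open>Maximality of the power is what makes a chain of rewriting steps running leftwards stop
  at \<gamma>.\<close>

lemma maximal_power_suffix:
  assumes "v \<noteq> []"
  shows "\<exists>\<gamma> m. w = \<gamma> @ concat (replicate m v) \<and> \<not> suffix v \<gamma>"
proof (induction "length w" arbitrary: w rule: less_induct)
  case less
  show ?case
  proof (cases "suffix v w")
    case True
    then obtain w' where w': "w = w' @ v" by (auto simp: suffix_def)
    then obtain \<gamma> m where "w' = \<gamma> @ concat (replicate m v)" "\<not> suffix v \<gamma>"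
      using less[of w'] assms by auto
    moreover have "concat (replicate m v) @ v = concat (replicate (Suc m) v)"
      using arg_cong[OF replicate_append_same[of m v], of concat] by simp
    ultimately show ?thesis using w' by (metis append.assoc)
  next
    case False
    then show ?thesis by (intro exI[of _ w] exI[of _ 0]) simp
  qed
qed

section \<open>Greedy compression of a block\<close>

declare suffix_snoc [simp del]

abbreviation singles :: "'a list \<Rightarrow> 'a list list" where
  "singles w \<equiv> map (\<lambda>a. [a]) w"

text \<open>A match consists of one-letter code words only. A finished block is thus never reopened,
  and the replacement is greedy from the left.\<close>

definition cstep :: "'a list \<Rightarrow> 'a list list \<Rightarrow> 'a \<Rightarrow> 'a list list" where
  "cstep p \<alpha> a = (let \<beta> = \<alpha> @ [[a]] in
     if suffix (singles p) \<beta> then take (length \<beta> - length p) \<beta> @ [p] else \<beta>)"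

definition crun :: "'a list \<Rightarrow> 'a list list \<Rightarrow> 'a list \<Rightarrow> 'a list list" where
  "crun p = foldl (cstep p)"

lemma crun_Nil [simp]: "crun p \<alpha> [] = \<alpha>"
  by (simp add: crun_def)

lemma crun_append: "crun p \<alpha> (v @ w) = crun p (crun p \<alpha> v) w"
  by (simp add: crun_def)

lemma crun_single [simp]: "crun p \<alpha> [a] = cstep p \<alpha> a"
  by (simp add: crun_def)

lemma cstep_plain: "\<not> suffix (singles p) (\<alpha> @ [[a]]) \<Longrightarrow> cstep p \<alpha> a = \<alpha> @ [[a]]"
  by (simp add: cstep_def Let_def)

lemma cstep_complete: "\<alpha> @ [[a]] = E @ singles p \<Longrightarrow> cstep p \<alpha> a = E @ [p]"
  by (simp add: cstep_def Let_def suffix_def)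

lemma cstep_cases:
  obtains (plain) "\<not> suffix (singles p) (\<alpha> @ [[a]])" "cstep p \<alpha> a = \<alpha> @ [[a]]"
    | (complete) E where "\<alpha> @ [[a]] = E @ singles p" "cstep p \<alpha> a = E @ [p]"
proof (cases "suffix (singles p) (\<alpha> @ [[a]])")
  case True
  then obtain E where "\<alpha> @ [[a]] = E @ singles p" by (auto simp: suffix_def)
  from complete[OF this cstep_complete[OF this]] show ?thesis .
next
  case False
  from plain[OF this cstep_plain[OF this]] show ?thesis .
qed

lemma concat_singles [simp]: "concat (singles w) = w"
  by (induction w) auto

lemma concat_cstep: "concat (cstep p \<alpha> a) = concat \<alpha> @ [a]"
proof (cases p \<alpha> a rule: cstep_cases)
  case (complete E)
  have "concat \<alpha> @ [a] = concat E @ p" using arg_cong[OF complete(1), of concat] by simp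
  then show ?thesis using complete(2) by simp
qed simp

lemma concat_crun: "concat (crun p \<alpha> w) = concat \<alpha> @ w"
  by (induction w rule: rev_induct) (simp_all add: crun_append concat_cstep)

text \<open>The block counts as a generator only if it lies over \<open>A\<close>. Completing it
  means that all its letters were read, so the condition holds whenever a block is actually
  produced.\<close>

lemma crun_in_lists:
  assumes "t \<in> lists ((\<lambda>a. [a]) ` A \<union> ({p} \<inter> lists A))" "w \<in> lists A"
  shows "crun p t w \<in> lists ((\<lambda>a. [a]) ` A \<union> ({p} \<inter> lists A))"
  using assms(2)
proof (induction w rule: rev_induct)
  case (snoc a w)
  let ?B = "(\<lambda>a. [a]) ` A \<union> ({p} \<inter> lists A)"
  have IH: "crun p t w @ [[a]] \<in> lists ?B" using snoc by auto
  show ?case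
  proof (cases p "crun p t w" a rule: cstep_cases)
    case plain
    then show ?thesis using IH by (simp add: crun_append)
  next
    case (complete E)
    then have E: "E \<in> lists ?B" "singles p \<in> lists ?B" using IH by (simp_all del: in_lists_conv_set)
    then have "p \<in> lists A" using concat_in_lists[OF E(2), of A] by fastforce
    then show ?thesis using complete E(1) by (auto simp: crun_append)
  qed
qed (use assms in simp)

text \<open>Length at least 2 distinguishes the block from every one-letter code word.\<close>

locale compression =
  fixes p :: "'a list"
  assumes length_p: "2 \<le> length p"
begin

lemma p_not_single: "p \<noteq> [a]" "p \<notin> set (singles w)"
  using length_p by auto

text \<open>A match reaching across a finished block would contain \<open>p\<close> itself among the
  one-letter words of \<open>singles p\<close>.\<close>

lemma suffix_barrier: "suffix (singles p) (E @ [p] @ s) \<longleftrightarrow> suffix (singles p) s"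
proof
  assume suf: "suffix (singles p) (E @ [p] @ s)"
  show "suffix (singles p) s"
  proof (cases "length p \<le> length s")
    case True
    moreover have "suffix s (E @ [p] @ s)" by (simp add: suffix_def)
    ultimately show ?thesis using suf by (auto intro: suffix_length_suffix)
  next
    case False
    moreover have "suffix ([p] @ s) (E @ [p] @ s)" by (simp add: suffix_def)
    ultimately have "suffix ([p] @ s) (singles p)" using suf by (auto intro: suffix_length_suffix)
    then have "p \<in> set (singles p)" by (auto dest!: set_mono_suffix)
    then show ?thesis using p_not_single by blast
  qed
next
  assume "suffix (singles p) s"
  then show "suffix (singles p) (E @ [p] @ s)" by (metis suffix_appendI)
qed

lemma crun_barrier: "crun p (E @ [p] @ s) w = E @ [p] @ crun p s w"
proof (induction w rule: rev_induct)
  case (snoc a w)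
  have "cstep p (E @ [p] @ t) a = E @ [p] @ cstep p t a" for t
  proof (cases p t a rule: cstep_cases)
    case plain
    then have "\<not> suffix (singles p) ((E @ [p] @ t) @ [[a]])"
      using suffix_barrier[of E "t @ [[a]]"] by simp
    then show ?thesis using plain cstep_plain by fastforce
  next
    case (complete E')
    then have "(E @ [p] @ t) @ [[a]] = (E @ [p] @ E') @ singles p" by simp
    from cstep_complete[OF this] show ?thesis using complete by simp
  qed
  then show ?case using snoc by (simp add: crun_append)
qed simp

lemma crun_short: "length w < length p \<Longrightarrow> crun p [] w = singles w"
proof (induction w rule: rev_induct)
  case (snoc a w)
  then have "\<not> suffix (singles p) (singles w @ [[a]])"
    by (auto dest: suffix_length_le)
  then show ?case using snoc by (simp add: crun_append cstep_plain)
qed simp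

definition separates :: "'a list list \<Rightarrow> bool" where
  "separates s \<longleftrightarrow> (\<forall>\<delta> e. suffix (singles p) (\<delta> @ s @ e) \<longrightarrow> suffix (singles p) (s @ e))"

text \<open>The property is an invariant of the run: appending a letter preserves it, and after a
  completion the new block shields everything to its left.\<close>

lemma crun_separates:
  assumes "separates s"
  shows "crun p (\<delta> @ s) w = \<delta> @ crun p s w"
proof -
  have "crun p (\<delta> @ s) w = \<delta> @ crun p s w \<and> separates (crun p s w)"
  proof (induction w rule: rev_induct)
    case (snoc a w)
    define t where "t = crun p s w"
    have t: "separates t" using snoc by (simp add: t_def)
    have "cstep p (\<delta> @ t) a = \<delta> @ cstep p t a \<and> separates (cstep p t a)"
    proof (cases p t a rule: cstep_cases)
      case plain
      then have "\<not> suffix (singles p) ((\<delta> @ t) @ [[a]])" using t by (auto simp: separates_def)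
      then have "cstep p (\<delta> @ t) a = \<delta> @ cstep p t a" using plain cstep_plain by fastforce
      moreover have "separates (t @ [[a]])" using t by (simp add: separates_def)
      ultimately show ?thesis using plain by simp
    next
      case (complete E)
      then have "(\<delta> @ t) @ [[a]] = (\<delta> @ E) @ singles p" by simp
      from cstep_complete[OF this] have "cstep p (\<delta> @ t) a = \<delta> @ cstep p t a"
        using complete by simp
      moreover have "separates (E @ [p])"
        unfolding separates_def using suffix_barrier by (metis append.assoc)
      ultimately show ?thesis using complete by simp
    qed
    then show ?case using snoc by (simp add: crun_append t_def)
  qed (use assms in simp)
  then show ?thesis by simp
qed

text \<open>No match is longer than \<open>p\<close>, so the last \<open>length p\<close> code
  letters are all that the coding ever has to remember.\<close>

lemma crun_locality:
  obtains \<delta> s where "\<alpha> = \<delta> @ s" "length s \<le> length p" "\<forall>w. crun p \<alpha> w = \<delta> @ crun p s w"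
proof (cases "length \<alpha> \<le> length p")
  case True
  then show ?thesis using that[of "[]" \<alpha>] by simp
next
  case False
  define \<delta> s where "\<delta> = take (length \<alpha> - length p) \<alpha>" and "s = drop (length \<alpha> - length p) \<alpha>"
  have \<alpha>: "\<alpha> = \<delta> @ s" "length s = length p" using False by (simp_all add: \<delta>_def s_def)
  have "separates s"
    unfolding separates_def
  proof (intro allI impI)
    fix \<gamma> e assume "suffix (singles p) (\<gamma> @ s @ e)"
    moreover have "suffix (s @ e) (\<gamma> @ s @ e)" by (simp add: suffix_def)
    ultimately show "suffix (singles p) (s @ e)"
      by (rule suffix_length_suffix) (simp add: \<alpha>)
  qed
  then show ?thesis using that[of \<delta> s] \<alpha> crun_separates by simp
qed

text \<open>Whatever was read before, exactly one block is completed while \<open>p\<close> is being read.\<close>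

lemma crun_read:
  obtains E r q where "p = r @ q" "r \<noteq> []" "E @ singles p = t @ singles r"
    "crun p t p = E @ [p] @ singles q"
proof -
  let ?P = "\<lambda>i. crun p t (take i p) = t @ singles (take i p)"
  \<comment> \<open>If nothing had been replaced, the code would now end in
    \<open>singles p\<close>, but the last step would have replaced exactly this suffix.\<close>
  have "\<not> ?P (length p)"
  proof
    assume "?P (length p)"
    then have eq: "crun p t p = t @ singles p" by simp
    obtain p' a where p: "p = p' @ [a]" using length_p by (cases p rule: rev_cases) auto
    show False
    proof (cases p "crun p t p'" a rule: cstep_cases)
      case plain
      have "crun p t p' @ [[a]] = t @ singles p"
        using eq plain(2) crun_append[of p t p' "[a]"] by (simp add: p[symmetric])
      then have "suffix (singles p) (crun p t p' @ [[a]])" by (rule suffixI)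
      with plain(1) show False by blast
    next
      case (complete E)
      then have "E @ [p] = t @ singles p" using eq crun_append[of p t p' "[a]"] by (simp add: p[symmetric])
      then have "p = last (singles p)" using length_p
        by (metis last_appendR last_snoc list.size(3) map_is_Nil_conv not_numeral_le_zero)
      then have "p \<in> set (singles p)" using length_p
        by (metis last_in_set list.size(3) map_is_Nil_conv not_numeral_le_zero)
      then show False using p_not_single by blast
    qed
  qed
  \<comment> \<open>The first completion occurs at letter number \<open>i\<close>. What remains of
    \<open>p\<close> is shorter than \<open>p\<close> and is read behind a barrier, so there is no
    second one.\<close>
  define i where "i = (LEAST i. \<not> ?P i)"
  have i: "\<not> ?P i" "\<And>j. j < i \<Longrightarrow> ?P j" "i \<le> length p"
    unfolding i_def using \<open>\<not> ?P (length p)\<close> by (rule LeastI, blast dest: not_less_Least, rule Least_le)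
  have "i \<noteq> 0"
  proof
    assume "i = 0"
    then show False using i(1) by simp
  qed
  then obtain j where j: "i = Suc j" "j < length p" using i(3) by (cases i) auto
  have Pj: "crun p t (take j p) = t @ singles (take j p)" using i(2)[of j] j by simp
  have run: "crun p t (take i p) = cstep p (t @ singles (take j p)) (p ! j)"
    using Pj by (simp add: j take_Suc_conv_app_nth crun_append)
  show ?thesis
  proof (cases p "t @ singles (take j p)" "p ! j" rule: cstep_cases)
    case plain
    then show ?thesis using i(1) run j by (simp add: take_Suc_conv_app_nth)
  next
    case (complete E)
    show ?thesis
    proof (rule that[of "take i p" "drop i p" E])
      show "take i p \<noteq> []" using j by auto
      show "E @ singles p = t @ singles (take i p)" using complete(1) j by (simp add: take_Suc_conv_app_nth)
      have "crun p t p = crun p (crun p t (take i p)) (drop i p)" by (simp flip: crun_append)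
      also have "\<dots> = E @ [p] @ crun p [] (drop i p)"
        using crun_barrier[of E "[]"] by (simp add: run complete)
      also have "crun p [] (drop i p) = singles (drop i p)" using j by (intro crun_short) simp
      finally show "crun p t p = E @ [p] @ singles (drop i p)" .
    qed simp
  qed
qed

text \<open>Each round emits one block and leaves a proper suffix of \<open>p\<close>, with
  \<open>length E + length q' = length q\<close>. The remainder can only shrink finitely often; once
  its length is stable, \<open>E\<close> is empty, the remainder recurs, and every further round
  adds just the block.\<close>

lemma crun_power_suffix:
  assumes "p = r @ q" "r \<noteq> []"
  shows "\<exists>N D q'. \<forall>j. crun p (singles q) (concat (replicate (N + j) p)) = D @ replicate j p @ q'"
  using assms
proof (induction "length q" arbitrary: r q rule: less_induct)
  case less
  obtain E r' q' where q': "p = r' @ q'" "r' \<noteq> []" "E @ singles p = singles q @ singles r'"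
      "crun p (singles q) p = E @ [p] @ singles q'"
    by (rule crun_read)
  have len: "length E + length q' = length q"
    using arg_cong[OF q'(3), of length] arg_cong[OF q'(1), of length] by simp
  have step: "crun p (singles q) (concat (replicate (Suc j) p))
      = E @ [p] @ crun p (singles q') (concat (replicate j p))" for j
    using crun_barrier[of E "singles q'"] by (simp add: crun_append q'(4))
  show ?case
  proof (cases "length q' < length q")
    case True
    from less(1)[OF this q'(1,2)] obtain N D s where
      "\<And>j. crun p (singles q') (concat (replicate (N + j) p)) = D @ replicate j p @ s"
      by blast
    then have "crun p (singles q) (concat (replicate (Suc N + j) p))
        = (E @ [p] @ D) @ replicate j p @ s" for j
      using step[of "N + j"] by simp
    then show ?thesis by blast
  next
    case False
    then have "length E = 0" and len': "length q' = length q" using len by linarith+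
    then have "E = []" by simp
    then have "q' = q" using q'(1) less(2) len' by (metis append_eq_append_conv)
    have "crun p (singles q) (concat (replicate j p)) = replicate j p @ singles q" for j
    proof (induction j)
      case (Suc j)
      then show ?case using step[of j] \<open>E = []\<close> \<open>q' = q\<close> by simp
    qed simp
    then have "\<forall>j. crun p (singles q) (concat (replicate (0 + j) p)) = [] @ replicate j p @ singles q"
      by simp
    then show ?thesis by blast
  qed
qed

lemma crun_power:
  "\<exists>N D q. \<forall>j. crun p t (concat (replicate (N + j) p)) = D @ replicate j p @ q"
proof -
  obtain E r q where q: "p = r @ q" "r \<noteq> []" "crun p t p = E @ [p] @ singles q"
    by (rule crun_read)
  from crun_power_suffix[OF q(1,2)] obtain N D s where
    "\<And>j. crun p (singles q) (concat (replicate (N + j) p)) = D @ replicate j p @ s" by blast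
  then have "crun p t (concat (replicate (Suc N + j) p)) = (E @ [p] @ D) @ replicate j p @ s" for j
    using crun_barrier[of E "singles q"] by (simp add: crun_append q(3))
  then show ?thesis by blast
qed

text \<open>After \<open>length p\<close> copies of \<open>y\<close>, a completed block would have
  to spell the last letters read, which are all equal to \<open>y\<close>.\<close>

lemma crun_letter_power:
  assumes "p \<noteq> replicate (length p) y"
  shows "\<exists>N D. \<forall>j. crun p t (replicate (N + j) y) = D @ replicate j [y]"
proof -
  have step: "crun p t (replicate (Suc i) y) = crun p t (replicate i y) @ [[y]]" if "length p \<le> i" for i
  proof -
    have snoc: "replicate (Suc i) y = replicate i y @ [y]" by (simp add: replicate_append_same)
    show ?thesis
    proof (cases p "crun p t (replicate i y)" y rule: cstep_cases)
      case plain
      then show ?thesis by (simp only: snoc crun_append crun_single)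
    next
      case (complete E)
      from arg_cong[OF this(1), of concat] have "concat t @ replicate (Suc i) y = concat E @ p"
        by (simp add: concat_crun replicate_append_same)
      then have "suffix p (concat t @ replicate (Suc i) y)" by (auto simp: suffix_def)
      moreover have "suffix (replicate (length p) y) (concat t @ replicate (Suc i) y)"
      proof -
        have "replicate (Suc i) y = replicate (Suc i - length p) y @ replicate (length p) y"
          using that by (simp flip: replicate_add)
        then show ?thesis unfolding suffix_def by (metis append.assoc)
      qed
      ultimately have "suffix p (replicate (length p) y)" by (rule suffix_length_suffix) simp
      then have "p = replicate (length p) y"
        by (metis in_set_replicate replicate_length_same set_mono_suffix subsetD)
      with assms show ?thesis by blast
    qed
  qed
  have "crun p t (replicate (length p + j) y) = crun p t (replicate (length p) y) @ replicate j [y]" for j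
  proof (induction j)
    case (Suc j)
    then show ?case using step[of "length p + j"] by (simp add: replicate_append_same)
  qed simp
  then show ?thesis by blast
qed

section \<open>Canonical code words\<close>

definition canonical :: "'a set \<Rightarrow> 'a list list set" where
  "canonical A = {\<alpha> \<in> lists ((\<lambda>a. [a]) ` A \<union> ({p} \<inter> lists A)). crun p [] (concat \<alpha>) = \<alpha>}"

text \<open>Let \<open>t\<close> be the code reached before \<open>b\<close> is read. A final
  one-letter word means that the last step was plain. A final block leaves no remainder behind it,
  so it consists exactly of the letters of \<open>b\<close> and nothing of \<open>t\<close> was
  consumed.\<close>

lemma canonical_butlast:
  assumes "\<alpha> @ [b] \<in> canonical A" shows "\<alpha> \<in> canonical A"
proof -
  define t where "t = crun p [] (concat \<alpha>)"
  have t: "crun p t b = \<alpha> @ [b]" using assms by (simp add: canonical_def t_def crun_append)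
  consider a where "b = [a]" | "b = p" using assms by (auto simp: canonical_def)
  then have "t = \<alpha>"
  proof cases
    case 1
    then have eq: "cstep p t a = \<alpha> @ [[a]]" using t by simp
    show ?thesis
    proof (cases p t a rule: cstep_cases)
      case plain
      then show ?thesis using eq by simp
    next
      case (complete E)
      then have "p = [a]" using eq by simp
      then show ?thesis using p_not_single(1) by blast
    qed
  next
    case 2
    obtain E r q where q: "p = r @ q" "E @ singles p = t @ singles r" "crun p t p = E @ [p] @ singles q"
      by (rule crun_read)
    then have eq: "\<alpha> @ [p] = E @ [p] @ singles q" using t 2 by simp
    have "q = []"
    proof (rule ccontr)
      assume "q \<noteq> []"
      then have "last (\<alpha> @ [p]) = [last q]" unfolding eq by (simp add: last_map)
      then show False using p_not_single(1) by simp
    qed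
    then show ?thesis using q eq by simp
  qed
  then show ?thesis using assms by (simp add: canonical_def t_def)
qed

lemma canonical_prefix: "\<alpha> @ \<beta> \<in> canonical A \<Longrightarrow> \<alpha> \<in> canonical A"
proof (induction \<beta> rule: rev_induct)
  case (snoc b \<beta>)
  then show ?case using canonical_butlast[of "\<alpha> @ \<beta>" b A] by simp
qed simp

text \<open>By locality a quotient depends on a bounded window at the end of \<open>w\<close>;
  prefixes that are not canonical have no canonical extension.\<close>

lemma fin_quot_canonical:
  assumes "finite A" shows "fin_quot (canonical A)"
proof (rule fin_quotI)
  let ?B = "(\<lambda>a. [a]) ` A \<union> ({p} \<inter> lists A)"
  let ?g = "\<lambda>s. {\<alpha> \<in> lists ?B. crun p s (concat \<alpha>) = s @ \<alpha>}"
  let ?S = "{s. set s \<subseteq> ?B \<and> length s \<le> length p}"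
  have "finite ?S" using assms by (intro finite_lists_length_le) auto
  then show "finite (insert {} (?g ` ?S))" by simp
  fix w
  show "lquot w (canonical A) \<in> insert {} (?g ` ?S)"
  proof (cases "w \<in> canonical A")
    case True
    then have w: "w \<in> lists ?B" "crun p [] (concat w) = w" by (auto simp: canonical_def)
    obtain \<delta> s where s: "w = \<delta> @ s" "length s \<le> length p" "\<forall>v. crun p w v = \<delta> @ crun p s v"
      by (rule crun_locality[of w])
    have "lquot w (canonical A) = {\<alpha> \<in> lists ?B. crun p w (concat \<alpha>) = w @ \<alpha>}"
      unfolding lquot_def canonical_def using w by (auto simp: crun_append)
    also have "\<dots> = ?g s" using s(1,3) by simp
    finally have "lquot w (canonical A) = ?g s" .
    moreover have "s \<in> ?S" using w s(1,2) by auto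
    ultimately show ?thesis by blast
  next
    case False
    then have "lquot w (canonical A) = {}" using canonical_prefix by (auto simp: lquot_def)
    then show ?thesis by simp
  qed
qed

end

section \<open>One convergent rule\<close>

text \<open>Here \<open>U\<close> is the leading side and \<open>[x, y]\<close> the other one.
  Keeping the orientation abstract lets the locale be instantiated also with the two sides of the
  given relation exchanged. The letter 0 is reserved for the adjoined identity.\<close>

locale one_rule =
  fixes A :: "nat set" and v :: "nat list" and c x y :: nat and U :: "nat list"
  assumes U_eq: "U = v @ [c]" and A: "finite A" "0 \<notin> A" and U: "U \<in> lists A" and v_nonempty: "v \<noteq> []"
    and xy: "x \<in> A" "y \<in> A"
    and normal_unique: "\<And>w w'. (w, w') \<in> congr_gen {(U, [x, y])} \<Longrightarrow> irr U w \<Longrightarrow> irr U w' \<Longrightarrow> w = w'"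
    and normal_exists: "\<And>w. \<exists>w'. (w, w') \<in> congr_gen {(U, [x, y])} \<and> irr U w'"
    and not_ending_xy: "drop (length U - 2) U \<noteq> [x, y]"
    and not_power: "U \<noteq> replicate (length v) y @ [x]"
begin

abbreviation R :: "(nat list \<times> nat list) set" where "R \<equiv> {(U, [x, y])}"

lemma length_U: "2 \<le> length U"
  using v_nonempty by (cases v) (auto simp: U_eq)

text \<open>For \<open>length v = 1\<close> the powers of \<open>v\<close> need no compression; the block \<open>[0, 0]\<close> never occurs.\<close>

definition p :: "nat list" where "p = (if length v = 1 then [0, 0] else v)"

sublocale compression p
proof
  have "length v = 1 \<or> 2 \<le> length v" using length_U by (auto simp: U_eq)
  then show "2 \<le> length p" unfolding p_def by auto
qed

definition B :: "nat list set" where "B = (\<lambda>a. [a]) ` A \<union> ({p} \<inter> lists A)"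

definition L :: "nat list list set" where
  "L = {\<alpha> \<in> canonical A. \<alpha> \<noteq> [] \<and> irr U (concat \<alpha>)}"

lemma congr_lists: "(w, w') \<in> congr_gen R \<Longrightarrow> w \<in> lists A \<longleftrightarrow> w' \<in> lists A"
  by (induction rule: congr_gen.induct) (use U xy in auto)

lemma congr_Nil: "(w, w') \<in> congr_gen R \<Longrightarrow> w = [] \<longleftrightarrow> w' = []"
  by (induction rule: congr_gen.induct) (auto simp: U_eq)

lemma L_lists: "L \<subseteq> lists B - {[]}"
  by (auto simp: L_def canonical_def B_def)

lemma B_lists: "B \<subseteq> lists A - {[]}"
  using length_p by (auto simp: B_def)

lemma finite_B: "finite B"
  using A(1) by (simp add: B_def)

lemma crun_in_B: "s \<in> lists B \<Longrightarrow> w \<in> lists A \<Longrightarrow> crun p s w \<in> lists B"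
  unfolding B_def by (rule crun_in_lists)

lemma crun_in_L:
  assumes "w \<in> lists A" "w \<noteq> []" "irr U w"
  shows "crun p [] w \<in> L"
proof -
  have "concat (crun p [] w) = w" by (simp add: concat_crun)
  moreover from this have "crun p [] w \<noteq> []" using assms(2) by auto
  moreover have "crun p [] w \<in> lists B" using assms(1) by (intro crun_in_B) auto
  ultimately show ?thesis using assms by (simp add: L_def canonical_def B_def)
qed

lemma L_crun: "\<alpha> \<in> L \<Longrightarrow> crun p [] (concat \<alpha>) = \<alpha>"
  by (simp add: L_def canonical_def)

lemma L_concat: "\<alpha> \<in> L \<Longrightarrow> concat \<alpha> \<in> lists A" "\<alpha> \<in> L \<Longrightarrow> irr U (concat \<alpha>)"
proof -
  assume "\<alpha> \<in> L"
  then have "\<alpha> \<in> lists B" using L_lists by blast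
  then show "concat \<alpha> \<in> lists A" using B_lists by (intro concat_in_lists[of \<alpha> B]) auto
qed (simp add: L_def)

lemma L_concat_nonempty: "\<alpha> \<in> L \<Longrightarrow> concat \<alpha> \<noteq> []"
proof -
  assume "\<alpha> \<in> L"
  then have "\<alpha> \<in> lists B" "\<alpha> \<noteq> []" using L_lists by auto
  then show ?thesis using B_lists by (cases \<alpha>) auto
qed

lemma L_unique: "\<alpha> \<in> L \<Longrightarrow> \<beta> \<in> L \<Longrightarrow> (concat \<alpha>, concat \<beta>) \<in> congr_gen R \<longleftrightarrow> \<alpha> = \<beta>"
  using normal_unique L_concat(2) L_crun congr_gen.refl by metis

lemma L_prefix: "\<alpha> @ \<beta> \<in> L \<Longrightarrow> \<alpha> \<noteq> [] \<Longrightarrow> \<alpha> \<in> L"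
  using canonical_prefix irr_prefix by (auto simp: L_def)

lemma fin_quot_L: "fin_quot L"
proof -
  have "L = canonical A \<inter> - {[]} \<inter> {\<alpha>. concat \<alpha> \<in> {w. irr U w}}" by (auto simp: L_def)
  moreover have "fin_quot {\<alpha>. concat \<alpha> \<in> {w. irr U w}}"
    by (rule fin_quot_vimage_hom[OF fin_quot_irr]) simp
  ultimately show ?thesis
    using A(1) by (simp only: fin_quot_Int fin_quot_canonical fin_quot_Compl fin_quot_singleton)
qed

lemma L_represents:
  assumes "w \<in> lists A" "w \<noteq> []"
  shows "\<exists>\<alpha>\<in>L. (w, concat \<alpha>) \<in> congr_gen R"
proof -
  obtain n where n: "(w, n) \<in> congr_gen R" "irr U n" using normal_exists by blast
  then have "n \<in> lists A" "n \<noteq> []" using assms congr_lists congr_Nil by blast+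
  then show ?thesis using n by (intro bexI[of _ "crun p [] n"]) (simp_all add: concat_crun crun_in_L)
qed

text \<open>For \<open>c = x\<close> the rule reads vx = xy: the letter \<open>x\<close> moves left
  across the copies of \<open>v\<close> and turns each of them into a \<open>y\<close>.\<close>

lemma power_congr:
  assumes "c = x \<or> m = 1"
  shows "(concat (replicate m v) @ [c], x # replicate m y) \<in> congr_gen R"
  using assms
proof
  assume "c = x"
  show ?thesis
  proof (induction m)
    case 0
    show ?case using \<open>c = x\<close> by (simp add: congr_gen.refl)
  next
    case (Suc m)
    have "(v @ concat (replicate m v) @ [c], v @ x # replicate m y) \<in> congr_gen R"
      using congr_gen_context[OF Suc, of v "[]"] by simp
    moreover have "(v @ x # replicate m y, [x, y] @ replicate m y) \<in> congr_gen R"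
      using congr_gen.base[of U "[x, y]" R "[]" "replicate m y"] \<open>c = x\<close> by (simp add: U_eq)
    ultimately show ?case by (auto intro: congr_gen.trans)
  qed
next
  assume "m = 1"
  then show ?thesis using congr_gen_self[of U "[x, y]" R] by (simp add: U_eq)
qed

text \<open>A redex ending at \<open>x\<close> forces \<open>c = x\<close> and a suffix
  \<open>v\<close> of \<gamma>. A redex ending at the first \<open>y\<close> would end in
  \<open>xy\<close>. One ending at a later \<open>y\<close> needs m > 1, hence \<open>c = x\<close>;
  it also forces \<open>c = y\<close>, so it again ends in \<open>xy\<close>.\<close>

lemma irr_power:
  assumes "irr U \<gamma>" "c = x \<Longrightarrow> \<not> suffix v \<gamma>" "c = x \<or> m = 1"
  shows "irr U (\<gamma> @ x # replicate m y)"
proof -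
  have "irr U (\<gamma> @ x # replicate i y)" if "i \<le> m" for i
    using that
  proof (induction i)
    case 0
    have "\<not> suffix U (\<gamma> @ [x])"
    proof
      assume "suffix U (\<gamma> @ [x])"
      then have "c = x" "suffix v \<gamma>" by (auto simp: U_eq suffix_def)
      then show False using assms(2) by blast
    qed
    then show ?case using assms(1) by (simp add: irr_snoc)
  next
    case (Suc i)
    have snoc: "\<gamma> @ x # replicate (Suc i) y = (\<gamma> @ x # replicate i y) @ [y]"
      by (simp add: replicate_append_same)
    have "\<not> suffix U (\<gamma> @ x # replicate (Suc i) y)"
    proof
      assume suf: "suffix U (\<gamma> @ x # replicate (Suc i) y)"
      obtain z where "\<gamma> @ x # replicate (Suc i) y = z @ [x, y]"
      proof (cases i)
        case 0
        then show ?thesis using that[of \<gamma>] by simp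
      next
        case (Suc i')
        then have "c = x" using assms(3) \<open>Suc i \<le> m\<close> by auto
        moreover have "c = y" using suf unfolding snoc by (auto simp: U_eq suffix_def)
        ultimately have "replicate (Suc i) y = replicate i' y @ [x, y]"
          using Suc replicate_add[of i' 2 y] by (simp add: numeral_2_eq_2)
        then show ?thesis using that[of "\<gamma> @ x # replicate i' y"] by simp
      qed
      then show False using suffix_two_letters[of U z x y] suf length_U not_ending_xy by simp
    qed
    moreover have "irr U (\<gamma> @ x # replicate i y)" using Suc by simp
    ultimately show ?case unfolding snoc irr_snoc by blast
  qed
  then show ?thesis by blast
qed

text \<open>If \<open>c = x\<close>, the power of \<open>v\<close> is stripped off completely. If
  \<open>c \<noteq> x\<close>, no redex can end in \<open>x\<close>, so a single step already gives
  the normal form although \<gamma> may end in \<open>v\<close>.\<close>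

lemma reducible_snoc:
  assumes "irr U w" "\<not> irr U (w @ [a])"
  obtains \<gamma> m where "a = c" "w = \<gamma> @ concat (replicate m v)" "c = x \<or> m = 1"
    "irr U (\<gamma> @ x # replicate m y)"
proof -
  have "suffix U (w @ [a])" using assms by (simp add: irr_snoc)
  then have "a = c" "suffix v w" by (auto simp: U_eq suffix_def)
  show ?thesis
  proof (cases "c = x")
    case True
    obtain \<gamma> m where w: "w = \<gamma> @ concat (replicate m v)" "\<not> suffix v \<gamma>"
      using maximal_power_suffix[OF v_nonempty] by blast
    then show ?thesis
      using that[of \<gamma> m] irr_power[of \<gamma> m] \<open>a = c\<close> True assms(1) irr_prefix by blast
  next
    case False
    obtain \<gamma> where w: "w = \<gamma> @ v" using \<open>suffix v w\<close> by (auto simp: suffix_def)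
    then show ?thesis
      using that[of \<gamma> 1] irr_power[of \<gamma> 1] \<open>a = c\<close> False assms(1) irr_prefix by auto
  qed
qed

text \<open>The windows provided by \<open>crun_locality\<close>: the part of the code of \<gamma>
  that can still influence what follows.\<close>

definition seeds :: "nat list list set" where
  "seeds = {s. set s \<subseteq> B \<and> length s \<le> length p}"

lemma finite_seeds: "finite seeds"
  unfolding seeds_def using finite_B by (rule finite_lists_length_le)

text \<open>The possible changes of a code word under right multiplication by the letter \<open>a\<close>, up to a
  common prefix.\<close>

definition tails :: "nat \<Rightarrow> (nat list list \<times> nat list list) set" where
  "tails a = (\<lambda>s. (s, crun p s [a])) ` seeds \<union>
     (if a = c then \<Union>s\<in>seeds. {(crun p s (concat (replicate m v)), crun p s (x # replicate m y))
        | m. c = x \<or> m = 1} else {})"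

lemma tails_sound: "(s, t) \<in> tails a \<Longrightarrow> (concat s @ [a], concat t) \<in> congr_gen R"
proof -
  assume "(s, t) \<in> tails a"
  then consider "t = crun p s [a]"
    | r m where "a = c" "c = x \<or> m = 1" "s = crun p r (concat (replicate m v))"
        "t = crun p r (x # replicate m y)"
    by (auto simp: tails_def split: if_splits)
  then show ?thesis
  proof cases
    case 1
    then show ?thesis by (simp add: concat_cstep congr_gen.refl)
  next
    case 2
    then show ?thesis
      using congr_gen_context[OF power_congr[OF 2(2)], of "concat r" "[]"] by (simp add: concat_crun)
  qed
qed

text \<open>Not every pair in \<open>tails\<close> arises from irreducible words, but each one is a
  valid product. Intersecting with \<open>L \<times> L\<close> discards the rest, so no
  compatibility between prefix, window and exponent has to be tracked.\<close>

lemma mult_rel_L: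
  assumes "a \<in> A"
  shows "mult_rel R L [a] = (L \<times> L) \<inter> {(\<delta> @ s, \<delta> @ t) | \<delta> s t. (s, t) \<in> tails a}"
proof (intro set_eqI iffI)
  fix z assume "z \<in> mult_rel R L [a]"
  then obtain \<alpha> \<beta> where z: "z = (\<alpha>, \<beta>)" "\<alpha> \<in> L" "\<beta> \<in> L"
    and congr: "(concat \<alpha> @ [a], concat \<beta>) \<in> congr_gen R"
    by (auto simp: mult_rel_def)
  have "\<exists>\<delta> s t. \<alpha> = \<delta> @ s \<and> \<beta> = \<delta> @ t \<and> (s, t) \<in> tails a"
  proof (cases "irr U (concat \<alpha> @ [a])")
    case True
    then have "concat \<beta> = concat \<alpha> @ [a]"
      using normal_unique[OF congr] L_concat(2)[OF z(3)] by simp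
    then have \<beta>: "\<beta> = crun p \<alpha> [a]"
      using L_crun[OF z(2)] L_crun[OF z(3)] by (simp add: crun_append)
    obtain \<delta> s where s: "\<alpha> = \<delta> @ s" "length s \<le> length p" "\<forall>w. crun p \<alpha> w = \<delta> @ crun p s w"
      by (rule crun_locality[of \<alpha>])
    have "set s \<subseteq> B" using z(2) s(1) L_lists by auto
    then have "(s, crun p s [a]) \<in> tails a" using s(2) by (simp add: tails_def seeds_def)
    then show ?thesis using s \<beta> by blast
  next
    case False
    obtain \<gamma> m where \<gamma>: "a = c" "concat \<alpha> = \<gamma> @ concat (replicate m v)" "c = x \<or> m = 1"
        "irr U (\<gamma> @ x # replicate m y)"
      by (rule reducible_snoc[OF L_concat(2)[OF z(2)] False])
    have "(concat \<alpha> @ [a], \<gamma> @ x # replicate m y) \<in> congr_gen R"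
      using congr_gen_context[OF power_congr[OF \<gamma>(3)], of \<gamma> "[]"] \<gamma>(1,2) by simp
    then have "concat \<beta> = \<gamma> @ x # replicate m y"
      using normal_unique congr L_concat(2)[OF z(3)] \<gamma>(4) congr_gen.trans congr_gen.sym by metis
    then have ab: "\<alpha> = crun p (crun p [] \<gamma>) (concat (replicate m v))"
        "\<beta> = crun p (crun p [] \<gamma>) (x # replicate m y)"
      using L_crun[OF z(2)] L_crun[OF z(3)] \<gamma>(2) by (simp_all flip: crun_append)
    obtain \<delta> s where s: "crun p [] \<gamma> = \<delta> @ s" "length s \<le> length p"
        "\<forall>w. crun p (crun p [] \<gamma>) w = \<delta> @ crun p s w"
      by (rule crun_locality[of "crun p [] \<gamma>"])
    have "\<gamma> \<in> lists A" using L_concat(1)[OF z(2)] \<gamma>(2) by simp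
    then have "crun p [] \<gamma> \<in> lists B" by (intro crun_in_B) auto
    then have "s \<in> seeds" using s(1,2) by (auto simp: seeds_def)
    then have "(crun p s (concat (replicate m v)), crun p s (x # replicate m y)) \<in> tails a"
      using \<gamma>(1,3) by (auto simp: tails_def)
    then show ?thesis using ab s(3) by blast
  qed
  then show "z \<in> (L \<times> L) \<inter> {(\<delta> @ s, \<delta> @ t) | \<delta> s t. (s, t) \<in> tails a}" using z by blast
next
  fix z assume "z \<in> (L \<times> L) \<inter> {(\<delta> @ s, \<delta> @ t) | \<delta> s t. (s, t) \<in> tails a}"
  then obtain \<delta> s t where z: "z = (\<delta> @ s, \<delta> @ t)" "\<delta> @ s \<in> L" "\<delta> @ t \<in> L" "(s, t) \<in> tails a"
    by blast
  then show "z \<in> mult_rel R L [a]"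
    using congr_gen_context[OF tails_sound[OF z(4)], of "concat \<delta>" "[]"] by (simp add: mult_rel_def)
qed

lemma crun_v_power: "\<exists>N D b q. \<forall>j. crun p s (concat (replicate (N + j) v)) = D @ replicate j b @ q"
proof (cases "length v = 1")
  case False
  then have "p = v" by (simp add: p_def)
  then show ?thesis using crun_power[of s] by metis
next
  case True
  then obtain b where b: "v = [b]" by (auto simp: length_Suc_conv)
  have power: "concat (replicate m v) = replicate m b" for m by (induction m) (simp_all add: b)
  \<comment> \<open>The dummy block is not a power of \<open>b\<close> because 0 is not in
    \<open>A\<close>, so the powers of \<open>v\<close> are spelled out letter by letter.\<close>
  have "p = [0, 0]" unfolding p_def using True by simp
  moreover have "b \<in> A" using U by (simp add: U_eq b)
  then have "b \<noteq> 0" using A(2) by metis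
  ultimately have "p \<noteq> replicate (length p) b" by simp
  then obtain N D where "\<forall>j. crun p s (replicate (N + j) b) = D @ replicate j [b]"
    using crun_letter_power by blast
  then have "\<forall>j. crun p s (concat (replicate (N + j) v)) = D @ replicate j [b] @ []"
    unfolding power by simp
  then show ?thesis by blast
qed

text \<open>Here the exclusion of y^(k-1)x enters: it keeps the powers of \<open>y\<close> free of
  blocks, up to a bounded beginning.\<close>

lemma p_not_y_power: "c = x \<Longrightarrow> p \<noteq> replicate (length p) y"
proof -
  assume "c = x"
  then have "v \<noteq> replicate (length v) y" using not_power by (simp add: U_eq)
  moreover have "y \<noteq> 0" using xy A(2) by metis
  ultimately show ?thesis unfolding p_def by simp
qed

text \<open>For \<open>c = x\<close> each unit of the exponent adds one code letter on either track:
  the code letter for \<open>v\<close> on the first, \<open>[y]\<close> on the second. Otherwise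
  each window contributes a single further pair.\<close>

lemma fin_quot_tails: "fin_quot (conv_lang (tails a))"
proof -
  let ?T = "\<lambda>s. {(crun p s (concat (replicate m v)), crun p s (x # replicate m y))
        | m. c = x \<or> m = 1}"
  have T: "fin_quot (conv_lang (?T s))" for s
  proof (cases "c = x")
    case True
    obtain N D b q where "\<And>j. crun p s (concat (replicate (N + j) v)) = D @ replicate j b @ q"
      using crun_v_power by blast
    moreover obtain N' D' where
      "\<And>j. crun p (cstep p s x) (replicate (N' + j) y) = D' @ replicate j [y]"
      using crun_letter_power[OF p_not_y_power[OF True]] by blast
    ultimately have "fin_quot (range (\<lambda>m. pad (crun p s (concat (replicate m v)))
        (crun p (cstep p s x) (replicate m y))))"
      by (rule fin_quot_pad_pump)
    moreover have "conv_lang (?T s) = range (\<lambda>m. pad (crun p s (concat (replicate m v)))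
        (crun p (cstep p s x) (replicate m y)))"
      using True by (auto simp: conv_lang_def crun_def)
    ultimately show ?thesis by simp
  next
    case False
    then have "conv_lang (?T s) = {pad (crun p s (concat (replicate 1 v))) (crun p s (x # replicate 1 y))}"
      by (auto simp: conv_lang_def)
    then show ?thesis by (simp only: fin_quot_singleton)
  qed
  have "conv_lang (\<Union>s\<in>seeds. ?T s) = (\<Union>s\<in>seeds. conv_lang (?T s))"
    unfolding conv_lang_def by blast
  then have "fin_quot (conv_lang (\<Union>s\<in>seeds. ?T s))"
    using T finite_seeds by (simp only: fin_quot_UNION)
  moreover have "conv_lang ((\<lambda>s. (s, crun p s [a])) ` seeds) = (\<lambda>s. pad s (crun p s [a])) ` seeds"
    by (auto simp: conv_lang_def)
  then have "fin_quot (conv_lang ((\<lambda>s. (s, crun p s [a])) ` seeds))"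
    using finite_seeds by (simp add: fin_quot_finite)
  moreover have "fin_quot (conv_lang ({} :: (nat list list \<times> nat list list) set))"
    by (simp add: conv_lang_def)
  ultimately show ?thesis
    unfolding tails_def conv_lang_Un by (cases "a = c") (simp_all add: fin_quot_Un)
qed

lemma fin_quot_mult_L: "a \<in> A \<Longrightarrow> fin_quot (conv_lang (mult_rel R L [a]))"
  by (simp add: mult_rel_L conv_lang_Int fin_quot_Int fin_quot_conv_Times fin_quot_L
      fin_quot_conv_common_prefix fin_quot_tails)

lemma fin_quot_eq_L: "fin_quot (conv_lang (mult_rel R L []))"
proof -
  have "mult_rel R L [] = (L \<times> L) \<inter> Id" using L_unique by (auto simp: mult_rel_def)
  then show ?thesis
    by (simp add: conv_lang_Int fin_quot_Int fin_quot_conv_Times fin_quot_L fin_quot_conv_Id)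
qed

theorem automatic: "automatic (sgp_carrier A R) (sgp_mult A R)"
proof -
  interpret word_coding A R B L
    by unfold_locales
      (use finite_B B_lists L_lists fin_quot_L L_represents fin_quot_eq_L fin_quot_mult_L in auto)
  show ?thesis using auto_structure_code unfolding automatic_def by blast
qed

section \<open>Adjoining the identity\<close>

abbreviation del0 :: "nat list \<Rightarrow> nat list" where
  "del0 \<equiv> removeAll 0"

lemma del0_lists: "w \<in> lists A \<Longrightarrow> del0 w = w"
  using A(2) by (auto intro: removeAll_id)

text \<open>The relations of the identity letter become equalities of words once 0 is deleted, and
  the original relation contains no 0.\<close>

lemma one_congr_del0: "(w, w') \<in> congr_gen (one_rels A R) \<Longrightarrow> (del0 w, del0 w') \<in> congr_gen R"
proof (induction rule: congr_gen.induct)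
  case (base u w l r)
  have "(del0 u, del0 w) \<in> congr_gen R"
  proof (cases "(u, w) \<in> R")
    case True
    then have "del0 u = u" "del0 w = w" using del0_lists[OF U] del0_lists[of "[x, y]"] xy by auto
    then show ?thesis using congr_gen_self[OF True] by simp
  next
    case False
    then obtain a where "u = [0, a] \<or> u = [a, 0]" "w = [a]"
      using base by (auto simp: one_rels_def)
    then have "del0 u = del0 w" by auto
    then show ?thesis by (simp add: congr_gen.refl)
  qed
  then show ?case using congr_gen_context by simp
qed (auto intro: congr_gen.intros)

lemma one_congr_normal:
  assumes "w \<in> lists (one_alph A)" "w \<noteq> []"
  shows "(w, if del0 w = [] then [0] else del0 w) \<in> congr_gen (one_rels A R)"
  using assms
proof (induction w)
  case (Cons a w)
  let ?C = "congr_gen (one_rels A R)" and ?N = "\<lambda>w. if del0 w = [] then [0] else del0 w"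
  show ?case
  proof (cases "w = []")
    case True
    then show ?thesis by (auto intro: congr_gen.refl)
  next
    case False
    then have IH: "(w, ?N w) \<in> ?C" using Cons by simp
    have aN: "(a # w, a # ?N w) \<in> ?C" using congr_gen_context[OF IH, of "[a]" "[]"] by simp
    have "(a # ?N w, ?N (a # w)) \<in> ?C"
    proof (cases "a = 0")
      case True
      obtain b N where N: "?N w = b # N" by (cases "?N w") (auto split: if_splits)
      have "set (?N w) \<subseteq> insert 0 (set w)" by auto
      then have "b = 0 \<or> b \<in> A" using Cons.hyps(2) N by (auto simp: one_alph_def)
      \<comment> \<open>If \<open>b\<close> is 0 itself, this is the relation ee = e.\<close>
      then have "([0, b], [b]) \<in> one_rels A R" by (auto simp: one_rels_def)
      from congr_gen.base[OF this, of "[]" N] have "(0 # ?N w, ?N w) \<in> ?C" unfolding N by simp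
      then show ?thesis using True by (auto split: if_splits)
    next
      case False
      moreover have "a \<in> one_alph A" using Cons.hyps(1) .
      ultimately have "a \<in> A" unfolding one_alph_def by blast
      then have "([a, 0], [a]) \<in> one_rels A R" by (simp add: one_rels_def)
      from congr_gen_self[OF this] show ?thesis using False by (auto intro: congr_gen.refl)
    qed
    with aN show ?thesis by (rule congr_gen.trans)
  qed
qed simp

text \<open>The words must be nonempty: \<open>[0]\<close> and the empty word agree after deletion,
  but no relation connects them.\<close>

lemma one_congr_iff:
  assumes "w \<in> lists (one_alph A)" "w \<noteq> []" "w' \<in> lists (one_alph A)" "w' \<noteq> []"
  shows "(w, w') \<in> congr_gen (one_rels A R) \<longleftrightarrow> (del0 w, del0 w') \<in> congr_gen R"
proof
  assume *: "(del0 w, del0 w') \<in> congr_gen R"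
  have "congr_gen R \<subseteq> congr_gen (one_rels A R)"
    by (rule congr_gen_minimal) (auto simp: one_rels_def intro: congr_gen_self)
  then have "(if del0 w = [] then [0] else del0 w, if del0 w' = [] then [0] else del0 w')
      \<in> congr_gen (one_rels A R)"
    using * congr_Nil[OF *] by (auto intro: congr_gen.refl)
  then show "(w, w') \<in> congr_gen (one_rels A R)"
    using one_congr_normal[OF assms(1,2)] one_congr_normal[OF assms(3,4)]
    by (blast intro: congr_gen.trans congr_gen.sym)
qed (rule one_congr_del0)

lemma mult_rel_one_del0:
  assumes "w \<in> lists (one_alph A)"
  shows "mult_rel (one_rels A R) (insert [[0]] L) w = {(\<alpha>, \<beta>). \<alpha> \<in> insert [[0]] L \<and>
    \<beta> \<in> insert [[0]] L \<and> (del0 (concat \<alpha>) @ del0 w, del0 (concat \<beta>)) \<in> congr_gen R}"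
proof -
  have *: "concat \<alpha> \<in> lists (one_alph A)" "concat \<alpha> \<noteq> []" if "\<alpha> \<in> insert [[0]] L" for \<alpha>
  proof -
    have "concat \<alpha> \<in> lists A \<and> concat \<alpha> \<noteq> []" if "\<alpha> \<in> L"
      using L_concat(1) L_concat_nonempty that by blast
    then show "concat \<alpha> \<in> lists (one_alph A)" "concat \<alpha> \<noteq> []" using that by (auto simp: one_alph_def)
  qed
  have "(concat \<alpha> @ w, concat \<beta>) \<in> congr_gen (one_rels A R)
      \<longleftrightarrow> (del0 (concat \<alpha>) @ del0 w, del0 (concat \<beta>)) \<in> congr_gen R"
    if "\<alpha> \<in> insert [[0]] L" "\<beta> \<in> insert [[0]] L" for \<alpha> \<beta>
    using one_congr_iff[of "concat \<alpha> @ w" "concat \<beta>"] *[OF that(1)] *[OF that(2)] assms by simp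
  then show ?thesis unfolding mult_rel_def by blast
qed

lemma L_del0: "\<alpha> \<in> L \<Longrightarrow> del0 (concat \<alpha>) = concat \<alpha>"
  by (intro del0_lists L_concat(1))

lemma zero_notin_L: "[[0]] \<notin> L"
  using L_concat(1)[of "[[0]]"] A(2) by auto

text \<open>A product with a letter of \<open>A\<close> is never the identity, so the only new
  products are those of the identity with \<open>a\<close>.\<close>

lemma mult_rel_one_letter:
  assumes "a \<in> A"
  shows "mult_rel (one_rels A R) (insert [[0]] L) [a] = mult_rel R L [a] \<union>
    {[[0]]} \<times> {\<beta> \<in> L. ([a], concat \<beta>) \<in> congr_gen R}"
proof -
  have "a \<noteq> 0" using assms A(2) by metis
  moreover have "[a] \<in> lists (one_alph A)" using assms by (simp add: one_alph_def)
  moreover have "(w @ [a], []) \<notin> congr_gen R" "([a], []) \<notin> congr_gen R" for w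
    using congr_Nil by blast+
  ultimately show ?thesis
    unfolding mult_rel_one_del0[OF \<open>[a] \<in> lists (one_alph A)\<close>]
    using zero_notin_L by (auto simp: mult_rel_def L_del0)
qed

lemma mult_rel_one_eq:
  "mult_rel (one_rels A R) (insert [[0]] L) [] = mult_rel R L [] \<union> {([[0]], [[0]])}"
  "mult_rel (one_rels A R) (insert [[0]] L) [0] = mult_rel R L [] \<union> {([[0]], [[0]])}"
proof -
  have "(concat \<beta>, []) \<notin> congr_gen R" "([], concat \<beta>) \<notin> congr_gen R" if "\<beta> \<in> L" for \<beta>
    using congr_Nil L_concat_nonempty[OF that] by blast+
  then show "mult_rel (one_rels A R) (insert [[0]] L) [] = mult_rel R L [] \<union> {([[0]], [[0]])}"
    "mult_rel (one_rels A R) (insert [[0]] L) [0] = mult_rel R L [] \<union> {([[0]], [[0]])}"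
    by (subst mult_rel_one_del0;
        fastforce simp: one_alph_def mult_rel_def L_del0 intro: congr_gen.refl)+
qed

theorem prefix_automatic_one:
  "prefix_automatic (sgp_carrier (one_alph A) (one_rels A R)) (sgp_mult (one_alph A) (one_rels A R))"
proof -
  have eq: "fin_quot (conv_lang (mult_rel R L [] \<union> {([[0]], [[0]])}))"
  proof -
    have "conv_lang {([[0 :: nat]], [[0]])} = {pad [[0]] [[0]]}" by (auto simp: conv_lang_def)
    then show ?thesis
      unfolding conv_lang_Un using fin_quot_eq_L fin_quot_singleton by (metis fin_quot_Un)
  qed
  interpret word_coding "one_alph A" "one_rels A R" "insert [0] B" "insert [[0]] L"
  proof
    show "finite (insert [0] B)" using finite_B by simp
    show "insert [0] B \<subseteq> lists (one_alph A) - {[]}" using B_lists by (auto simp: one_alph_def)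
    show "insert [[0]] L \<subseteq> lists (insert [0] B) - {[]}" using L_lists by auto
    show "fin_quot (insert [[0]] L)"
      using fin_quot_Un[OF fin_quot_singleton fin_quot_L, of "[[0]]"] by simp
  next
    fix w assume w: "w \<in> lists (one_alph A)" "w \<noteq> []"
    show "\<exists>\<alpha>\<in>insert [[0]] L. (w, concat \<alpha>) \<in> congr_gen (one_rels A R)"
    proof (cases "del0 w = []")
      case True
      then show ?thesis using one_congr_normal[OF w] by simp
    next
      case False
      moreover have "del0 w \<in> lists A" using w(1) by (auto simp: one_alph_def)
      ultimately obtain \<alpha> where \<alpha>: "\<alpha> \<in> L" "(del0 w, concat \<alpha>) \<in> congr_gen R"
        using L_represents by blast
      have "concat \<alpha> \<in> lists (one_alph A)" using L_concat(1)[OF \<alpha>(1)] by (auto simp: one_alph_def)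
      then have "(w, concat \<alpha>) \<in> congr_gen (one_rels A R)"
        using one_congr_iff[OF w, of "concat \<alpha>"] L_concat_nonempty[OF \<alpha>(1)] \<alpha> by (simp add: L_del0)
      then show ?thesis using \<alpha>(1) by blast
    qed
  next
    show "fin_quot (conv_lang (mult_rel (one_rels A R) (insert [[0]] L) []))"
      unfolding mult_rel_one_eq by (rule eq)
  next
    fix a assume "a \<in> one_alph A"
    then consider "a = 0" | "a \<in> A" by (auto simp: one_alph_def)
    then show "fin_quot (conv_lang (mult_rel (one_rels A R) (insert [[0]] L) [a]))"
    proof cases
      case 1
      show ?thesis unfolding 1 mult_rel_one_eq by (rule eq)
    next
      case 2
      let ?F = "{\<beta> \<in> L. ([a], concat \<beta>) \<in> congr_gen R}"
      \<comment> \<open>The letter \<open>a\<close> has only one code word, so the adjoined identity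
        contributes finitely many pairs.\<close>
      have "\<beta> = \<gamma>" if "\<beta> \<in> ?F" "\<gamma> \<in> ?F" for \<beta> \<gamma>
        using that L_unique[of \<beta> \<gamma>] by (blast intro: congr_gen.trans congr_gen.sym)
      then have "?F = {} \<or> (\<exists>\<beta>. ?F = {\<beta>})" by blast
      then have "finite ?F" by (elim disjE exE; simp only: finite.emptyI finite.insertI)
      moreover have "conv_lang ({[[0]]} \<times> ?F) = pad [[0]] ` ?F" by (auto simp: conv_lang_def)
      ultimately have "fin_quot (conv_lang ({[[0]]} \<times> ?F))" by (simp add: fin_quot_finite)
      then show ?thesis
        unfolding mult_rel_one_letter[OF 2] conv_lang_Un by (intro fin_quot_Un fin_quot_mult_L 2)
    qed
  qed
  show ?thesis
  proof (rule prefix_automatic_code)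
    fix \<alpha> \<beta> assume "\<alpha> @ \<beta> \<in> insert [[0]] L" "\<alpha> \<noteq> []"
    then show "\<alpha> \<in> insert [[0]] L"
      using L_prefix by (auto simp: append_eq_Cons_conv)
  qed
qed

end

text \<open>For the orientation in which \<open>xy\<close> is leading; \<open>Q\<close> carries
  along the relations of the identity letter.\<close>

lemma congr_gen_swap:
  "congr_gen ({(v, w)} \<union> Q) = congr_gen ({(w, v)} \<union> Q)"
proof -
  have "congr_gen ({(v, w)} \<union> Q) \<subseteq> congr_gen ({(w, v)} \<union> Q)" for v w
    by (rule congr_gen_minimal) (auto intro: congr_gen_self congr_gen_self_sym)
  then show ?thesis by blast
qed

lemma sgp_cong:
  assumes "congr_gen Q = congr_gen Q'"
  shows "sgp_carrier A Q = sgp_carrier A Q'" "sgp_mult A Q = sgp_mult A Q'"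
  using assms by (simp_all add: sgp_carrier_def sgp_mult_def cls_def fun_eq_iff)

theorem theorem3p1p6:
  fixes n k x y :: nat and u :: "nat list"
  assumes "k \<ge> 2" and "length u = k" and "set u \<subseteq> {1..n}"
    and "x \<in> {1..n}" and "y \<in> {1..n}"
    and "\<exists>\<rho>. inj_on \<rho> {1..n} \<and>
           GSB \<rho> {1..n} {(\<lambda>w. (if w = u then 1 else 0) - (if w = [x, y] then 1 else 0))
                            :: nat list \<Rightarrow> 'k::field}"
    and "drop (k - 2) u \<noteq> [x, y]"
    and "u \<noteq> replicate (k - 1) y @ [x]"
  shows "automatic (sgp_carrier {1..n} {(u, [x, y])}) (sgp_mult {1..n} {(u, [x, y])}) \<and>
         prefix_automatic (sgp_carrier (one_alph {1..n}) (one_rels {1..n} {(u, [x, y])}))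
                          (sgp_mult (one_alph {1..n}) (one_rels {1..n} {(u, [x, y])}))"
proof -
  obtain \<rho> where "GSB \<rho> {1..n}
      {(\<lambda>w. (if w = u then 1 else 0) - (if w = [x, y] then 1 else 0)) :: nat list \<Rightarrow> 'k::field}"
    using assms(6) by blast
  moreover have lists: "u \<in> lists {1..n}" "[x, y] \<in> lists {1..n}" using assms(3-5) by auto
  ultimately consider
      (u) "dlex_less \<rho> [x, y] u" "overlaps_trivial \<rho> u [x, y]"
    | (xy) "dlex_less \<rho> u [x, y]" "overlaps_trivial \<rho> [x, y] u"
    using GSB_binomial[OF HOL.refl] by blast
  then show ?thesis
  proof cases
    case u
    obtain v c where v: "u = v @ [c]" "v \<noteq> []"
      using assms(1,2) by (cases u rule: rev_cases) force+
    interpret one_rule "{1..n}" v c x y u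
      by unfold_locales (use assms lists v irr_unique[OF u] irr_exists[OF u] in auto)
    show ?thesis using automatic prefix_automatic_one by blast
  next
    case xy
    \<comment> \<open>Only possible for \<open>k = 2\<close> and in characteristic 2; both hypotheses on \<open>u\<close> are symmetric in \<open>u\<close> and \<open>xy\<close> then.\<close>
    then have "length u = 2" using assms(1,2) by (auto simp: dlex_less_def)
    then obtain b d where bd: "u = [b, d]" by (auto simp: length_Suc_conv numeral_2_eq_2)
    interpret one_rule "{1..n}" "[x]" y b d "[x, y]"
    proof
      show "(v, w) \<in> congr_gen {([x, y], [b, d])} \<Longrightarrow> irr [x, y] v \<Longrightarrow> irr [x, y] w \<Longrightarrow> v = w" for v w
        using irr_unique[OF xy] unfolding bd by blast
      show "\<exists>n. (w, n) \<in> congr_gen {([x, y], [b, d])} \<and> irr [x, y] n" for w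
        using irr_exists[OF xy] unfolding bd by blast
    qed (use assms lists bd in auto)
    have S: "congr_gen {(u, [x, y])} = congr_gen {([x, y], [b, d])}"
      using congr_gen_swap[of u "[x, y]" "{}"] bd by simp
    have S1: "congr_gen (one_rels {1..n} {(u, [x, y])}) = congr_gen (one_rels {1..n} {([x, y], [b, d])})"
      unfolding one_rels_def Un_assoc bd by (rule congr_gen_swap)
    show ?thesis
      unfolding sgp_cong[OF S] sgp_cong[OF S1] using automatic prefix_automatic_one by blast
  qed
qed

end
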